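(* Let $\tilde\eta,\eta,j,\delta_j^*,\delta_j,\beta,\alpha_j,\delta_{\beta,j},\Delta_2,\Delta_1$ be chosen as described in the context, and let $M_0,M_1\subset[-\alpha_j,\alpha_j]\times[\Delta_1,\Delta_2]$ be the disjoint sets defined there. Then for every sequence $(s_n)_{n=0}^{\infty}$ in $\{0,1\}$ there are forward trajectories $(x_n)_{n=0}^{\infty}$ of the return map in the plane $Q_j$ (that is, $x_{n+1}=Q_j(x_n)$ for all $n\ge0$) in $[-\alpha_j,\alpha_j]\times[\Delta_1,\Delta_2]$ with $$x_n\in M_{s_n}\quad\text{and}\quad \Delta_1\le Q_{j,2}(x_n)\le\Delta_2\quad\text{for all integers } n\ge0,$$ where $Q_{j,2}$ denotes the second component of $Q_j$.
   Context: BASIC SETTING. Let $\sigma<0<\mu$ and $u>0$ be reals with $\sigma+u>0$. $\mathbb{R}^n$ carries the Euclidean norm $|\cdot|$ and linear maps the operator norm. $e_1,e_2,e_3$ is the canonical basis of $\mathbb{R}^3$, $L=\mathbb{R}e_1\oplus\mathbb{R}e_2$, $U=\mathbb{R}e_3$; $P_L,P_U$ are the orthogonal projections of $\mathbb{R}^3$ onto $L$, $U$. Lower indices denote components; $\mathbb{N}=\{1,2,\dots\}$. A set $M$ is invariant under a flow $G$ in a set $N$ if for every $x\in M\cap N$ and every interval $J\ni0$ with $G(J\times\{x\})\subset N$ one has $G(J\times\{x\})\subset M$. $F:\mathbb{R}\times\mathbb{R}^3\to\mathbb{R}^3$ is a continuously differentiable flow (arising, by conjugation with a $C^1$ diffeomorphism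 of $\mathbb{R}^3$ fixing $0$, from the flow of a bounded $C^1$ vectorfield $V$ on $\mathbb{R}^3$ with $V(0)=0$, with a homoclinic solution, and with eigenvalues $u,\sigma\pm i\mu$ of $DV(0)$), and $h:\mathbb{R}\to\mathbb{R}^3$ is a flowline of $F$ ($h(t+s)=F(t,h(s))$), such that: (F1) $F(t,0)=0$ for all $t$. (F2) $h(t)\ne0\ne h'(t)$ for all $t$ and $h(t)\to0$ as $|t|\to\infty$. (F3) $T(t)=D_2F(t,0)$ maps $L$ into $L$ and $U$ into $U$, and $y=T(t)x$ is given by $y_1=e^{\sigma t}(\cos(\mu t)x_1+\sin(\mu t)x_2)$, $y_2=e^{\sigma t}(-\sin(\mu t)x_1+\cos(\mu t)x_2)$, $y_3=e^{ut}x_3$. (F4) For some $r_F>0$, $L$ and $U$ are invariant under $F$ in $\{|x|<r_F\}$. (F5) There are $t_U<t_L$ with $h(t)\in(0,\infty)e_3$ for $t\le t_U$ and $h(t)\in L$ for $t\ge t_L$. For $\epsilon>0$ let $F_\epsilon(t,x)=\frac1\epsilon F(t,\epsilon x)$ and $h_\epsilon=\frac1\epsilon h$. Let $B_1=\{x:|P_Lx|\le1,|P_Ux|\le1\}$, $r_B=2(\max_{0\le t\le1}|T(t)|+e^u+2)$, $B=\{|x|\le r_B\}$. For each $\eta>0$ fix $\epsilon(\eta)>0$ such that $|D_2F_\epsilon(t,x)-T(t)|<\eta$ for all $0<\epsilon<\epsilon(\eta)$, $t\in[0,1]$, $x\in B_1$; fix $\epsilon_B>0$ such that for $0<\epsilon<\epsilon_B$,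 $F_\epsilon([0,1]\times B_1)\subset B$ and $L,U$ are invariant under $F_\epsilon$ in $B$ (such numbers exist). EXTERIOR MAPS. $M_I=\{z\in\mathbb{R}^3:|P_Lz|=1\}$, $M_E=e_3+L$, $M_E(r)=\{y\in M_E:|y-e_3|<r\}$. For $0<\epsilon<|h(t_U)|$ fix $t_{E,\epsilon}\le t_U$ with $h_\epsilon(t_{E,\epsilon})=e_3$. Fix strictly monotonic sequences $(t_{I,j})_{j\in\mathbb{N}}$ in $[t_L,\infty)$, $t_{I,j}\to\infty$, and $(\epsilon_j)_{j\in\mathbb{N}}$ in $(0,\infty)$, $\epsilon_j\to0$, with $\epsilon_j<|h(t_U)|$, $|h_{\epsilon_j}(t_{I,j})|=1$, $(|h_{\epsilon_j}|^2)'(t_{I,j})<0$, $h_{\epsilon_j}(t)\in L$ for $t\ge t_{I,j}$. Fix a decreasing sequence $r_j\to0$ of positive reals and $C^1$ maps $t_j:M_E(r_j)\to(0,\infty)$ with $t_j(e_3)=t_{I,j}-t_{E,\epsilon_j}$, $F_{\epsilon_j}(t_j(y),y)\in\{z\in M_I:P_Lz\ne-h_{\epsilon_j}(t_{I,j})\}$ and $\partial_1F_{\epsilon_j}(0,y)\notin L$ for all $y\in M_E(r_j)$. The exterior map is $E_j:M_E(r_j)\to\{z\in M_I:P_Lz\ne-h_{\epsilon_j}(t_{I,j})\}$, $E_j(y)=F_{\epsilon_j}(t_j(y),y)$; so $E_j(e_3)=h_{\epsilon_j}(t_{I,j})$. (All these objects exist.) CONDITIONS (C) on $\tilde\eta,\eta,j,\delta_j^*,\delta_j$: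 with $m(\eta,\sigma)=\max\{\log(1+\eta e^{-\sigma}),\log\frac{1}{1-\eta e^{-\sigma}},\arcsin\frac{\eta}{e^\sigma-\eta}\}$, one has $0<\eta<\frac{e^\sigma}{2}$, $1+\eta e^{-\sigma}<e^{-\sigma/2}$, $m(\eta,\sigma)<\tilde\eta$; $j\in\mathbb{N}$ with $\epsilon_j<\min\{\epsilon(\eta),\epsilon_B\}$; $\delta_j^*\in(0,1)$ with $1+\frac2\sigma\log(r_j)<\frac{1}{u+\log 2}\log\frac{1}{\delta_j^*}-1$; $\delta_j\in(0,\delta_j^* )$ with $\frac{1}{u+\log2}\log\frac1{\delta_j}-1>\frac{m(\eta,\sigma)}{\tilde\eta-m(\eta,\sigma)}$. INNER MAP. For $x\in M_I$ with $0<x_3<1$, $\tau_{\epsilon_j}(x)>0$ is the time with $0<F_{\epsilon_j,3}(s,x)<1$ for $0\le s<\tau_{\epsilon_j}(x)$ and $F_{\epsilon_j,3}(\tau_{\epsilon_j}(x),x)=1$ (it exists). $M_{I,j}=\{x\in M_I:0<x_3<\delta_j,\ P_Lx\ne-E_j(e_3)\}$, $\tau_j=\tau_{\epsilon_j}|_{M_{I,j}}$, $I_j:M_{I,j}\to M_E$, $I_j(x)=F_{\epsilon_j}(\tau_j(x),x)$, which has values in $M_E(r_j)$. COORDINATES. $\omega_j\in[-\pi,\pi)$ is given by $(\cos\omega_j,\sin\omega_j,0)=E_j(e_3)$. $K_j:(-\pi,\pi)\times\mathbb{R}\to\{x\in M_I:P_Lx\ne-E_j(e_3)\}$, $K_j(\psi,\delta)=(\cos(\omega_j+\psi),\sin(\omega_j+\psi),\delta)$,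 a $C^1$ diffeomorphism. The return map in the plane is $Q_j:(-\pi,\pi)\times(0,\delta_j)\to(-\pi,\pi)\times\mathbb{R}$, $Q_j=K_j^{-1}\circ E_j\circ I_j\circ K_j$. The derivative $T_{e_3}(K_j^{-1}\circ E_j):L\to\mathbb{R}^2$ is an isomorphism; $v_j,w_j\in L$ are the vectors it sends to $(1,0)$ and $(0,1)$. $\kappa_j:L\to\mathbb{R}^2$ is the isomorphism $\kappa_j(\xi v_j+\zeta w_j)=(\xi,\zeta)$, and $P_j$ is the restriction of $\kappa_j\circ P_L$ to $M_E(r_j)$, a diffeomorphism onto an open neighbourhood of $0$ in $\mathbb{R}^2$. For $\beta>0$, $\alpha_j(\beta)\in(0,\pi)$ denotes a number such that for all $p\in[-\alpha_j(\beta),\alpha_j(\beta)]^2$: $p\in P_j(M_E(r_j))$, $|(K_j^{-1}\circ E_j\circ P_j^{-1})(p)-p|\le\beta|p|$ and $|D(K_j^{-1}\circ E_j\circ P_j^{-1})(p)-\mathrm{id}|\le\beta$ (arbitrarily small such numbers exist). ANGLE FUNCTION. For $(\psi,\delta)\in(-\pi,\pi)\times(0,\delta_j)$ and $x=K_j(\psi,\delta)$ the path $t\mapsto P_LF_{\epsilon_j}(t,x)$ has no zero on $[0,\tau_j(x)]$; $\Phi_j(\psi,\delta)=\theta(\tau_j(x))$, where $\theta:[0,\tau_j(x)]\to\mathbb{R}$ is the unique continuous function with $\theta(0)=\omega_j+\psi$ and $P_LF_{\epsilon_j}(t,x)/|P_LF_{\epsilon_j}(t,x)|=(\cos\theta(t),\sin\theta(t),0)$.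 $\Phi_j$ is continuous. CHOICES. $0<\tilde\eta<\min\{\mu,-\sigma/2\}$; $c=\frac{(u+\tilde\eta)(\mu+\tilde\eta)}{(u-\tilde\eta)(\mu-\tilde\eta)}$, $k=e^{-6\pi\frac{u+\tilde\eta}{\mu-\tilde\eta}}$, and $\tilde\eta$ satisfies $c\,\frac{-\sigma+\tilde\eta}{u-\tilde\eta}<1$. $\eta,j,\delta_j^*,\delta_j$ satisfy (C). $\beta\in(0,1/2]$, $\alpha_j=\alpha_j(\beta)$ with $\alpha_j<\delta_j$, and $\delta_{\beta,j}=\left(\frac{2}{3(|\kappa_j|+1)}\alpha_j\right)^{3u/(-\sigma)}$ (which is $\le\frac23\alpha_j$). $\Delta_2\in(0,\delta_{\beta,j})$ satisfies $2\sqrt2\,\Delta_2<\frac{1}{|\kappa_j^{-1}|}k^{\frac{-\sigma+\tilde\eta}{u-\tilde\eta}}\Delta_2^{c\frac{-\sigma+\tilde\eta}{u-\tilde\eta}}$, and $\Delta_1=k\Delta_2^c$ $(<\Delta_2)$. With $m_1=\max_{|\gamma|\le\alpha_j}\Phi_j(\gamma,\Delta_1)$ and $m_2=\min_{|\psi|\le\alpha_j}\Phi_j(\psi,\Delta_2)$ one has $m_1+4\pi\le m_2$; $\psi_j\in[m_1+\pi,m_2-\pi]$ is chosen with $(\cos\psi_j,\sin\psi_j,0)=w_j/|w_j|$. Finally $M_0=\{(\psi,\delta)\in[-\alpha_j,\alpha_j]\times[\Delta_1,\Delta_2]:\psi_j-\pi<\Phi_j(\psi,\delta)<\psi_j\}$,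 $M_1=\{(\psi,\delta)\in[-\alpha_j,\alpha_j]\times[\Delta_1,\Delta_2]:\psi_j<\Phi_j(\psi,\delta)<\psi_j+\pi\}$. *)

theory Defs
  imports "HOL-Analysis.Analysis"
begin

subsection \<open>Coordinates on three-dimensional space\<close>

definition e3 :: "real^3" where
  "e3 = axis 3 1"

definition Lsp :: "(real^3) set" where
  "Lsp = span {axis 1 1, axis 2 1}"

definition Usp :: "(real^3) set" where
  "Usp = span {axis 3 1}"

definition PL :: "real^3 \<Rightarrow> real^3" where
  "PL x = vector [x$1, x$2, 0]"

definition PU :: "real^3 \<Rightarrow> real^3" where
  "PU x = vector [0, 0, x$3]"

lemma Lsp_iff: "x \<in> Lsp \<longleftrightarrow> x$3 = 0"
proof
  assume "x \<in> Lsp"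
  then show "x$3 = 0"
    unfolding Lsp_def
    by (induction rule: span_induct_alt) (auto simp: axis_def)
next
  assume "x$3 = 0"
  then have "x = x$1 *\<^sub>R axis 1 1 + x$2 *\<^sub>R axis 2 1"
    by (auto simp: vec_eq_iff forall_3 axis_def)
  also have "\<dots> \<in> Lsp"
    unfolding Lsp_def by (intro span_add span_scale span_base) auto
  finally show "x \<in> Lsp" .
qed

lemma Usp_iff: "x \<in> Usp \<longleftrightarrow> x$1 = 0 \<and> x$2 = 0"
proof
  assume "x \<in> Usp"
  then show "x$1 = 0 \<and> x$2 = 0"
    unfolding Usp_def
    by (induction rule: span_induct_alt) (auto simp: axis_def)
next
  assume "x$1 = 0 \<and> x$2 = 0"
  then have "x = x$3 *\<^sub>R axis 3 1"
    by (auto simp: vec_eq_iff forall_3 axis_def)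
  also have "\<dots> \<in> Usp"
    unfolding Usp_def by (intro span_scale span_base) auto
  finally show "x \<in> Usp" .
qed

lemma PL_orthogonal_projection:
  "PL x \<in> Lsp" "y \<in> Lsp \<Longrightarrow> orthogonal (x - PL x) y"
  by (auto simp: Lsp_iff PL_def orthogonal_def inner_vec_def sum_3)

lemma PU_orthogonal_projection:
  "PU x \<in> Usp" "y \<in> Usp \<Longrightarrow> orthogonal (x - PU x) y"
  by (auto simp: Usp_iff PU_def orthogonal_def inner_vec_def sum_3)

subsection \<open>Differentiability, flows, invariance\<close>

text \<open>Used for open sets \<open>S\<close> and for relatively open subsets \<open>S\<close> of an affine
  subspace. In the latter case the extension \<open>f' x\<close> of the tangential derivative to the
  whole space is not unique, but existence of a continuous extension is equivalent to
  continuous differentiability along \<open>S\<close>.\<close>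

definition C1_on :: "'a::real_normed_vector set \<Rightarrow> ('a \<Rightarrow> 'b::real_normed_vector) \<Rightarrow> bool" where
  "C1_on S f \<longleftrightarrow>
    (\<exists>f' :: 'a \<Rightarrow> ('a \<Rightarrow>\<^sub>L 'b). continuous_on S f' \<and>
      (\<forall>x\<in>S. (f has_derivative blinfun_apply (f' x)) (at x within S)))"

definition C1_diffeo :: "('a::real_normed_vector \<Rightarrow> 'a) \<Rightarrow> bool" where
  "C1_diffeo H \<longleftrightarrow> bij H \<and> C1_on UNIV H \<and> C1_on UNIV (inv H)"

definition is_flow :: "(real \<Rightarrow> 'a \<Rightarrow> 'a) \<Rightarrow> bool" where
  "is_flow F \<longleftrightarrow> (\<forall>x. F 0 x = x) \<and> (\<forall>t s x. F (t + s) x = F t (F s x))"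

definition solution :: "('a::real_normed_vector \<Rightarrow> 'a) \<Rightarrow> (real \<Rightarrow> 'a) \<Rightarrow> bool" where
  "solution V g \<longleftrightarrow> (\<forall>t. (g has_vector_derivative V (g t)) (at t))"

definition flow_of :: "('a::real_normed_vector \<Rightarrow> 'a) \<Rightarrow> (real \<Rightarrow> 'a \<Rightarrow> 'a) \<Rightarrow> bool" where
  "flow_of V G \<longleftrightarrow> is_flow G \<and> (\<forall>x. solution V (\<lambda>t. G t x))"

definition homoclinic :: "('a::real_normed_vector \<Rightarrow> 'a) \<Rightarrow> (real \<Rightarrow> 'a) \<Rightarrow> bool" where
  "homoclinic V g \<longleftrightarrow> solution V g \<and> (\<forall>t. g t \<noteq> 0) \<and>
    (g \<longlongrightarrow> 0) at_top \<and> (g \<longlongrightarrow> 0) at_bot"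

definition complex_eigenvalue :: "(real^3 \<Rightarrow> real^3) \<Rightarrow> complex \<Rightarrow> bool" where
  "complex_eigenvalue A z \<longleftrightarrow>
    (\<exists>w::complex^3. w \<noteq> 0 \<and> (\<chi> i k. complex_of_real (matrix A $ i $ k)) *v w = z *s w)"

definition invariant_in :: "(real \<Rightarrow> 'a \<Rightarrow> 'a) \<Rightarrow> 'a set \<Rightarrow> 'a set \<Rightarrow> bool" where
  "invariant_in G M N \<longleftrightarrow>
    (\<forall>x\<in>M \<inter> N. \<forall>J. is_interval J \<and> 0 \<in> J \<and> (\<forall>t\<in>J. G t x \<in> N) \<longrightarrow> (\<forall>t\<in>J. G t x \<in> M))"

definition D2 :: "(real \<Rightarrow> real^3 \<Rightarrow> real^3) \<Rightarrow> real \<Rightarrow> real^3 \<Rightarrow> real^3 \<Rightarrow> real^3" where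
  "D2 F t x = frechet_derivative (F t) (at x)"

text \<open>Operator norm of a linear map that is only meaningful on a subspace \<open>S\<close>.
  As for \<open>onorm\<close>, the term for \<open>x = 0\<close> is \<open>0\<close>.\<close>

definition onorm_on :: "'a::real_normed_vector set \<Rightarrow> ('a \<Rightarrow> 'b::real_normed_vector) \<Rightarrow> real" where
  "onorm_on S f = (SUP x\<in>S. norm (f x) / norm x)"

subsection \<open>The flow and its homoclinic flowline\<close>

definition conjugate_to_vectorfield_flow ::
  "real \<Rightarrow> real \<Rightarrow> real \<Rightarrow> (real \<Rightarrow> real^3 \<Rightarrow> real^3) \<Rightarrow> bool" where
  "conjugate_to_vectorfield_flow \<sigma> \<mu> u F \<longleftrightarrow>
    (\<exists>V G g H.
      bounded (range V) \<and> C1_on UNIV V \<and> V 0 = 0 \<and> flow_of V G \<and> homoclinic V g \<and>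
      {z. complex_eigenvalue (frechet_derivative V (at 0)) z}
        = {complex_of_real u, Complex \<sigma> \<mu>, Complex \<sigma> (-\<mu>)} \<and>
      C1_diffeo H \<and> H 0 = 0 \<and> (\<forall>t x. F t x = H (G t (inv H x))))"

definition basic_setting ::
  "real \<Rightarrow> real \<Rightarrow> real \<Rightarrow> (real \<Rightarrow> real^3 \<Rightarrow> real^3) \<Rightarrow> (real \<Rightarrow> real^3) \<Rightarrow> real \<Rightarrow> real \<Rightarrow> bool" where
  "basic_setting \<sigma> \<mu> u F h tU tL \<longleftrightarrow>
    \<sigma> < 0 \<and> 0 < \<mu> \<and> 0 < u \<and> 0 < \<sigma> + u \<and>
    is_flow F \<and> C1_on UNIV (\<lambda>(t, x). F t x) \<and>
    conjugate_to_vectorfield_flow \<sigma> \<mu> u F \<and>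
    (\<forall>t s. h (t + s) = F t (h s)) \<and>
    \<comment> \<open>(F1)\<close>
    (\<forall>t. F t 0 = 0) \<and>
    \<comment> \<open>(F2)\<close>
    (\<forall>t. h t \<noteq> 0 \<and> vector_derivative h (at t) \<noteq> 0) \<and>
    (h \<longlongrightarrow> 0) at_top \<and> (h \<longlongrightarrow> 0) at_bot \<and>
    \<comment> \<open>(F3)\<close>
    (\<forall>t. D2 F t 0 ` Lsp \<subseteq> Lsp \<and> D2 F t 0 ` Usp \<subseteq> Usp) \<and>
    (\<forall>t x. D2 F t 0 x =
      vector [exp (\<sigma> * t) * (cos (\<mu> * t) * x$1 + sin (\<mu> * t) * x$2),
              exp (\<sigma> * t) * (- sin (\<mu> * t) * x$1 + cos (\<mu> * t) * x$2),
              exp (u * t) * x$3]) \<and>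
    \<comment> \<open>(F4)\<close>
    (\<exists>rF>0. invariant_in F Lsp {x. norm x < rF} \<and> invariant_in F Usp {x. norm x < rF}) \<and>
    \<comment> \<open>(F5)\<close>
    tU < tL \<and> (\<forall>t\<le>tU. \<exists>a>0. h t = a *\<^sub>R e3) \<and> (\<forall>t\<ge>tL. h t \<in> Lsp)"

definition scaled_flow ::
  "real \<Rightarrow> (real \<Rightarrow> real^3 \<Rightarrow> real^3) \<Rightarrow> real \<Rightarrow> real^3 \<Rightarrow> real^3" where
  "scaled_flow \<epsilon> F t x = (1 / \<epsilon>) *\<^sub>R F t (\<epsilon> *\<^sub>R x)"

definition scaled_curve :: "real \<Rightarrow> (real \<Rightarrow> real^3) \<Rightarrow> real \<Rightarrow> real^3" where
  "scaled_curve \<epsilon> h t = (1 / \<epsilon>) *\<^sub>R h t"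

definition B1 :: "(real^3) set" where
  "B1 = {x. norm (PL x) \<le> 1 \<and> norm (PU x) \<le> 1}"

definition rB :: "real \<Rightarrow> (real \<Rightarrow> real^3 \<Rightarrow> real^3) \<Rightarrow> real" where
  "rB u F = 2 * ((SUP t\<in>{0..1}. onorm (D2 F t 0)) + exp u + 2)"

definition rescaling_bounds ::
  "real \<Rightarrow> (real \<Rightarrow> real^3 \<Rightarrow> real^3) \<Rightarrow> (real \<Rightarrow> real) \<Rightarrow> real \<Rightarrow> bool" where
  "rescaling_bounds u F epsfun epsB \<longleftrightarrow>
    (\<forall>\<eta>>0. epsfun \<eta> > 0 \<and>
      (\<forall>\<epsilon> t x. 0 < \<epsilon> \<and> \<epsilon> < epsfun \<eta> \<and> t \<in> {0..1} \<and> x \<in> B1 \<longrightarrow>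
        onorm (\<lambda>v. D2 (scaled_flow \<epsilon> F) t x v - D2 F t 0 v) < \<eta>)) \<and>
    epsB > 0 \<and>
    (\<forall>\<epsilon>. 0 < \<epsilon> \<and> \<epsilon> < epsB \<longrightarrow>
      (\<forall>t\<in>{0..1}. \<forall>x\<in>B1. scaled_flow \<epsilon> F t x \<in> cball 0 (rB u F)) \<and>
      invariant_in (scaled_flow \<epsilon> F) Lsp (cball 0 (rB u F)) \<and>
      invariant_in (scaled_flow \<epsilon> F) Usp (cball 0 (rB u F)))"

subsection \<open>Exterior maps\<close>

definition MI :: "(real^3) set" where
  "MI = {z. norm (PL z) = 1}"

definition ME :: "real \<Rightarrow> (real^3) set" where
  "ME r = {y. (\<exists>x\<in>Lsp. y = e3 + x) \<and> norm (y - e3) < r}"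

text \<open>All sequences are indexed by the positive integers; their values at \<open>0\<close> are irrelevant.\<close>

definition exterior_data ::
  "(real \<Rightarrow> real^3 \<Rightarrow> real^3) \<Rightarrow> (real \<Rightarrow> real^3) \<Rightarrow> real \<Rightarrow> real \<Rightarrow> (real \<Rightarrow> real) \<Rightarrow>
   (nat \<Rightarrow> real) \<Rightarrow> (nat \<Rightarrow> real) \<Rightarrow> (nat \<Rightarrow> real) \<Rightarrow> (nat \<Rightarrow> real^3 \<Rightarrow> real) \<Rightarrow> bool" where
  "exterior_data F h tU tL tE tI eps r tt \<longleftrightarrow>
    (\<forall>\<epsilon>. 0 < \<epsilon> \<and> \<epsilon> < norm (h tU) \<longrightarrow> tE \<epsilon> \<le> tU \<and> scaled_curve \<epsilon> h (tE \<epsilon>) = e3) \<and>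
    strict_mono_on {1..} tI \<and> filterlim tI at_top sequentially \<and>
    strict_antimono_on {1..} eps \<and> eps \<longlonglongrightarrow> 0 \<and>
    antimono_on {1..} r \<and> r \<longlonglongrightarrow> 0 \<and>
    (\<forall>j\<ge>1.
      tL \<le> tI j \<and> 0 < eps j \<and> eps j < norm (h tU) \<and>
      norm (scaled_curve (eps j) h (tI j)) = 1 \<and>
      deriv (\<lambda>t. (norm (scaled_curve (eps j) h t))\<^sup>2) (tI j) < 0 \<and>
      (\<forall>t\<ge>tI j. scaled_curve (eps j) h t \<in> Lsp) \<and>
      0 < r j \<and> C1_on (ME (r j)) (tt j) \<and> tt j e3 = tI j - tE (eps j) \<and>
      (\<forall>y\<in>ME (r j).
        0 < tt j y \<and>
        scaled_flow (eps j) F (tt j y) y \<in> {z\<in>MI. PL z \<noteq> - scaled_curve (eps j) h (tI j)} \<and>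
        vector_derivative (\<lambda>t. scaled_flow (eps j) F t y) (at 0) \<notin> Lsp))"

subsection \<open>Conditions (C)\<close>

definition mC :: "real \<Rightarrow> real \<Rightarrow> real" where
  "mC \<eta> \<sigma> = Max {ln (1 + \<eta> * exp (-\<sigma>)), ln (1 / (1 - \<eta> * exp (-\<sigma>))), arcsin (\<eta> / (exp \<sigma> - \<eta>))}"

definition conditions_C ::
  "real \<Rightarrow> real \<Rightarrow> (real \<Rightarrow> real) \<Rightarrow> real \<Rightarrow> (nat \<Rightarrow> real) \<Rightarrow> (nat \<Rightarrow> real) \<Rightarrow>
   real \<Rightarrow> real \<Rightarrow> nat \<Rightarrow> real \<Rightarrow> real \<Rightarrow> bool" where
  "conditions_C \<sigma> u epsfun epsB eps r \<eta>t \<eta> j \<delta>star \<delta>j \<longleftrightarrow>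
    0 < \<eta> \<and> \<eta> < exp \<sigma> / 2 \<and> 1 + \<eta> * exp (-\<sigma>) < exp (-\<sigma> / 2) \<and> mC \<eta> \<sigma> < \<eta>t \<and>
    j \<ge> 1 \<and> eps j < min (epsfun \<eta>) epsB \<and>
    0 < \<delta>star \<and> \<delta>star < 1 \<and>
    1 + (2 / \<sigma>) * ln (r j) < (1 / (u + ln 2)) * ln (1 / \<delta>star) - 1 \<and>
    0 < \<delta>j \<and> \<delta>j < \<delta>star \<and>
    (1 / (u + ln 2)) * ln (1 / \<delta>j) - 1 > mC \<eta> \<sigma> / (\<eta>t - mC \<eta> \<sigma>)"

subsection \<open>Inner map, coordinates, angle function\<close>

text \<open>Here \<open>G\<close> stands for a rescaled flow. The value of \<open>exit_time\<close> is meaningful for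
  \<open>x \<in> MI\<close> with \<open>0 < x$3 < 1\<close>.\<close>

definition exit_time :: "(real \<Rightarrow> real^3 \<Rightarrow> real^3) \<Rightarrow> real^3 \<Rightarrow> real" where
  "exit_time G x = (THE \<tau>. 0 < \<tau> \<and> (\<forall>s. 0 \<le> s \<and> s < \<tau> \<longrightarrow> 0 < G s x $ 3 \<and> G s x $ 3 < 1) \<and>
     G \<tau> x $ 3 = 1)"

definition inner_map :: "(real \<Rightarrow> real^3 \<Rightarrow> real^3) \<Rightarrow> real^3 \<Rightarrow> real^3" where
  "inner_map G x = G (exit_time G x) x"

definition cyl :: "real \<Rightarrow> real \<times> real \<Rightarrow> real^3" where
  "cyl \<omega> = (\<lambda>(\<psi>, \<delta>). vector [cos (\<omega> + \<psi>), sin (\<omega> + \<psi>), \<delta>])"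

definition cyl_inv :: "real \<Rightarrow> real^3 \<Rightarrow> real \<times> real" where
  "cyl_inv \<omega> = inv_into ({-pi<..<pi} \<times> UNIV) (cyl \<omega>)"

text \<open>Derivative at \<open>e3\<close> of a map \<open>f\<close> defined on a neighbourhood of \<open>e3\<close> in the plane
  \<open>e3 + Lsp\<close>; it is to be applied to vectors in the tangent space \<open>Lsp\<close> only.\<close>

definition tangent_map :: "(real^3 \<Rightarrow> real \<times> real) \<Rightarrow> real^3 \<Rightarrow> real \<times> real" where
  "tangent_map f = frechet_derivative (\<lambda>x. f (e3 + PL x)) (at 0)"

text \<open>Coordinates on \<open>Lsp\<close> with respect to a basis \<open>v, w\<close> of \<open>Lsp\<close>.\<close>

definition basis_coords :: "real^3 \<Rightarrow> real^3 \<Rightarrow> real^3 \<Rightarrow> real \<times> real" where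
  "basis_coords v w x = (THE (\<xi>, \<zeta>). x = \<xi> *\<^sub>R v + \<zeta> *\<^sub>R w)"

definition angle_fun :: "(real \<Rightarrow> real^3 \<Rightarrow> real^3) \<Rightarrow> real \<Rightarrow> real \<times> real \<Rightarrow> real" where
  "angle_fun G \<omega> p =
    (THE a. \<exists>\<theta>. continuous_on {0..exit_time G (cyl \<omega> p)} \<theta> \<and>
       \<theta> 0 = \<omega> + fst p \<and>
       (\<forall>t\<in>{0..exit_time G (cyl \<omega> p)}.
          (1 / norm (PL (G t (cyl \<omega> p)))) *\<^sub>R PL (G t (cyl \<omega> p)) = vector [cos (\<theta> t), sin (\<theta> t), 0]) \<and>
       a = \<theta> (exit_time G (cyl \<omega> p)))"

text \<open>The defining property of \<open>\<alpha>\<close> for given \<open>\<beta>\<close>, where \<open>P\<close> is injective on the domain \<open>M\<close>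
  and \<open>f\<close> is the map on \<open>M\<close> that is compared with \<open>P\<close>.\<close>

definition near_identity_square ::
  "(real^3) set \<Rightarrow> (real^3 \<Rightarrow> real \<times> real) \<Rightarrow> (real^3 \<Rightarrow> real \<times> real) \<Rightarrow> real \<Rightarrow> real \<Rightarrow> bool" where
  "near_identity_square M P f \<beta> \<alpha> \<longleftrightarrow>
    (\<forall>p \<in> {-\<alpha>..\<alpha>} \<times> {-\<alpha>..\<alpha>}.
      p \<in> P ` M \<and>
      norm ((f \<circ> inv_into M P) p - p) \<le> \<beta> * norm p \<and>
      onorm (\<lambda>z. frechet_derivative (f \<circ> inv_into M P) (at p) z - z) \<le> \<beta>)"

end

theory Submission
  imports Defs
begin

text \<open>
  In the box the flow is close to its linearization, hence along the inner map the height \<open>\<delta>\<close> and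
  the distance \<open>\<rho>\<close> of the exit point from the axis satisfy
  \<open>\<delta> powr ((-\<sigma> + \<eta>t) / (u - \<eta>t)) \<le> \<rho> \<le> \<delta> powr ((-\<sigma> - \<eta>t) / (u + \<eta>t))\<close>.
  In the coordinates \<open>\<kappa>\<close> the exterior map is nearly the identity, so the return map \<open>Q\<close> is determined
  up to a relative error of \<open>1 / 2\<close> by \<open>\<rho>\<close> and the angle \<open>\<Phi>\<close>. The upper bound keeps the
  first component of \<open>Q\<close> within \<open>\<alpha>\<close>, the lower bound gives \<open>snd Q > \<Delta>2\<close> where \<open>\<Phi> = \<psi>j\<close>
  and \<open>snd Q < \<Delta>1\<close> where \<open>\<Phi> = \<psi>j \<plusminus> pi\<close>. A curve joining the edges \<open>\<delta> = \<Delta>1\<close> and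
  \<open>\<delta> = \<Delta>2\<close> therefore contains, in each of \<open>M0\<close> and \<open>M1\<close>, an arc which \<open>Q\<close> maps to a curve of
  the same kind, and nested parameter intervals yield a point with any prescribed itinerary.
\<close>

subsection \<open>Curves and itineraries\<close>

definition crosses :: "(real \<Rightarrow> real) \<Rightarrow> real \<Rightarrow> real \<Rightarrow> real \<Rightarrow> real \<Rightarrow> bool" where
  "crosses f a b y z \<longleftrightarrow> (f a \<le> y \<and> z \<le> f b) \<or> (f b \<le> y \<and> z \<le> f a)"

text \<open>Take for \<open>b'\<close> the first time at which \<open>f\<close> reaches
  \<open>z\<close>, and for \<open>a'\<close> the last time before \<open>b'\<close> at which
  \<open>f\<close> equals \<open>y\<close>. By the intermediate value theorem \<open>f\<close>
  cannot leave the band in between.\<close>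

lemma ascending_subinterval:
  fixes f :: "real \<Rightarrow> real"
  assumes "continuous_on {a..b} f" "a \<le> b" "y < z" "f a \<le> y" "z \<le> f b"
  obtains a' b' where "a \<le> a'" "a' \<le> b'" "b' \<le> b" "f a' = y" "f b' = z" "f ` {a'..b'} \<subseteq> {y..z}"
proof -
  define B where "B = {t \<in> {a..b}. f t = z}"
  have cB: "closed B"
    unfolding B_def using continuous_closed_preimage_constant[OF assms(1)] by auto
  have neB: "B \<noteq> {}"
    using IVT'[of f a z b] assms by (auto simp: B_def)
  have bB: "bdd_below B" by (auto simp: B_def bdd_below_def)
  define b' where "b' = Inf B"
  have b': "b' \<in> B" unfolding b'_def by (rule closed_contains_Inf[OF neB bB cB])
  have below: "f t < z" if t: "t \<in> {a..<b'}" for t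
  proof (rule ccontr)
    assume "\<not> f t < z"
    moreover have "continuous_on {a..t} f"
      using that b' by (intro continuous_on_subset[OF assms(1)]) (auto simp: B_def)
    ultimately obtain s where "a \<le> s" "s \<le> t" "f s = z"
      using IVT'[of f a z t] t assms by auto
    then have "s \<in> B" using that b' by (auto simp: B_def)
    then have "b' \<le> s" unfolding b'_def by (rule cInf_lower[OF _ bB])
    with \<open>s \<le> t\<close> that show False by auto
  qed
  define A where "A = {t \<in> {a..b'}. f t = y}"
  have cb': "continuous_on {a..b'} f"
    using b' by (intro continuous_on_subset[OF assms(1)]) (auto simp: B_def)
  have cA: "closed A"
    unfolding A_def using continuous_closed_preimage_constant[OF cb'] by auto
  have neA: "A \<noteq> {}"
    using IVT'[of f a y b'] assms b' cb' by (auto simp: A_def B_def)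
  have bA: "bdd_above A" by (auto simp: A_def bdd_above_def)
  define a' where "a' = Sup A"
  have a': "a' \<in> A" unfolding a'_def by (rule closed_contains_Sup[OF neA bA cA])
  have above: "y < f t" if t: "t \<in> {a'<..b'}" for t
  proof (rule ccontr)
    assume "\<not> y < f t"
    moreover have "continuous_on {t..b'} f"
      using that a' by (intro continuous_on_subset[OF cb']) (auto simp: A_def)
    ultimately obtain s where "t \<le> s" "s \<le> b'" "f s = y"
      using IVT'[of f t y b'] t assms b' by (auto simp: B_def)
    then have "s \<in> A" using that a' by (auto simp: A_def)
    then have "s \<le> a'" unfolding a'_def by (rule cSup_upper[OF _ bA])
    with \<open>t \<le> s\<close> that show False by auto
  qed
  have "f t \<in> {y..z}" if "t \<in> {a'..b'}" for t
    using below[of t] above[of t] that a' b' \<open>y < z\<close>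
    by (cases "t = a'"; cases "t = b'") (auto simp: A_def B_def)
  then show thesis
    using a' b' by (intro that[of a' b']) (auto simp: A_def B_def)
qed

text \<open>A descending crossing of \<open>f\<close> is an ascending one of \<open>- f\<close>. The
  end values are attained exactly, so that facts about level sets can be applied at the
  ends.\<close>

lemma crossing_subinterval:
  fixes f :: "real \<Rightarrow> real"
  assumes "continuous_on {a..b} f" "a \<le> b" "y < z" "crosses f a b y z"
  obtains a' b' where "a \<le> a'" "a' \<le> b'" "b' \<le> b" "f ` {a'..b'} \<subseteq> {y..z}"
    "(f a' = y \<and> f b' = z) \<or> (f a' = z \<and> f b' = y)"
proof -
  consider "f a \<le> y \<and> z \<le> f b" | "f b \<le> y \<and> z \<le> f a"
    using assms(4) by (auto simp: crosses_def)
  then show thesis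
  proof cases
    case 1
    then show thesis
      using ascending_subinterval[OF assms(1-3)] that by metis
  next
    case 2
    obtain a' b' where "a \<le> a'" "a' \<le> b'" "b' \<le> b" "- f a' = - z" "- f b' = - y"
      "(\<lambda>t. - f t) ` {a'..b'} \<subseteq> {- z..- y}"
    proof (rule ascending_subinterval[of a b "\<lambda>t. - f t" "- z" "- y"])
      show "continuous_on {a..b} (\<lambda>t. - f t)" by (intro continuous_intros assms)
    qed (use assms 2 in auto)
    then show thesis by (intro that[of a' b']) auto
  qed
qed

text \<open>A topological horseshoe: only crossing properties of continuous curves are used, no
  contraction or hyperbolicity, so the trajectory found need not be unique.\<close>

lemma itinerary_trajectories:
  fixes \<Phi> :: "real \<times> real \<Rightarrow> real" and Q :: "real \<times> real \<Rightarrow> real \<times> real"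
  assumes ab: "0 \<le> \<alpha>" "y < z"
    and R: "R = {-\<alpha>..\<alpha>} \<times> {y..z}"
    and cont: "continuous_on R \<Phi>" "continuous_on R Q"
    and fst_Q: "\<And>p. p \<in> R \<Longrightarrow> fst (Q p) \<in> {-\<alpha>..\<alpha>}"
    and low: "\<And>\<psi>. \<psi> \<in> {-\<alpha>..\<alpha>} \<Longrightarrow> \<Phi> (\<psi>, y) \<le> \<theta> - l"
    and high: "\<And>\<psi>. \<psi> \<in> {-\<alpha>..\<alpha>} \<Longrightarrow> \<theta> + l \<le> \<Phi> (\<psi>, z)"
    and l: "0 < l"
    and mid: "\<And>p. p \<in> R \<Longrightarrow> \<Phi> p = \<theta> \<Longrightarrow> z < snd (Q p)"
    and sides: "\<And>p. p \<in> R \<Longrightarrow> \<Phi> p = \<theta> - l \<or> \<Phi> p = \<theta> + l \<Longrightarrow> snd (Q p) < y"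
    and M0: "M0 = {p \<in> R. \<theta> - l < \<Phi> p \<and> \<Phi> p < \<theta>}"
    and M1: "M1 = {p \<in> R. \<theta> < \<Phi> p \<and> \<Phi> p < \<theta> + l}"
  shows "\<exists>x. (\<forall>n. x (Suc n) = Q (x n)) \<and> (\<forall>n. x n \<in> (if s n = (0::nat) then M0 else M1))"
proof -
  \<comment> \<open>The parameter of a curve is never rescaled, so arcs selected for successive
    iterates correspond to nested intervals.\<close>
  define vert where "vert \<gamma> a b \<longleftrightarrow> a \<le> b \<and> continuous_on {a..b} \<gamma> \<and> \<gamma> ` {a..b} \<subseteq> R \<and>
    crosses (\<lambda>t. snd (\<gamma> t)) a b y z" for \<gamma> :: "real \<Rightarrow> real \<times> real" and a b
  have step: "\<exists>a' b'. a \<le> a' \<and> b' \<le> b \<and> vert (\<lambda>t. Q (\<gamma> t)) a' b' \<and>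
      \<gamma> ` {a'..b'} \<subseteq> (if i = 0 then M0 else M1)" if v: "vert \<gamma> a b" for \<gamma> a b and i :: nat
  proof -
    have c\<gamma>: "continuous_on {a..b} \<gamma>" and \<gamma>R: "\<gamma> ` {a..b} \<subseteq> R" and "a \<le> b"
      using v by (auto simp: vert_def)
    \<comment> \<open>The band of values of \<open>\<Phi>\<close> that belongs to the symbol
      \<open>i\<close>. One end is \<open>\<theta>\<close>, governed by \<open>mid\<close>; the
      other is \<open>\<theta> - l\<close> or \<open>\<theta> + l\<close>, governed by
      \<open>sides\<close>.\<close>
    define lo hi where "lo = (if i = 0 then \<theta> - l else \<theta>)" and "hi = (if i = 0 then \<theta> else \<theta> + l)"
    have "lo < hi" using l by (auto simp: lo_def hi_def)
    have c\<Phi>: "continuous_on {a..b} (\<lambda>t. \<Phi> (\<gamma> t))"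
      using continuous_on_compose2[OF cont(1) c\<gamma> \<gamma>R] .
    \<comment> \<open>Inside \<open>R\<close> the condition \<open>snd (\<gamma> t) \<le> y\<close>
      puts the point on the bottom edge, so \<open>low\<close> applies.\<close>
    have end_low: "\<Phi> (\<gamma> t) \<le> lo" if "t \<in> {a..b}" "snd (\<gamma> t) \<le> y" for t
    proof -
      have "\<gamma> t \<in> R" using that \<gamma>R by auto
      then have "\<Phi> (\<gamma> t) \<le> \<theta> - l"
        using low[of "fst (\<gamma> t)"] that by (cases "\<gamma> t") (auto simp: R)
      then show ?thesis using l by (auto simp: lo_def)
    qed
    have end_high: "hi \<le> \<Phi> (\<gamma> t)" if "t \<in> {a..b}" "z \<le> snd (\<gamma> t)" for t
    proof -
      have "\<gamma> t \<in> R" using that \<gamma>R by auto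
      then have "\<theta> + l \<le> \<Phi> (\<gamma> t)"
        using high[of "fst (\<gamma> t)"] that by (cases "\<gamma> t") (auto simp: R)
      then show ?thesis using l by (auto simp: hi_def)
    qed
    have "crosses (\<lambda>t. \<Phi> (\<gamma> t)) a b lo hi"
      using v end_low[of a] end_low[of b] end_high[of a] end_high[of b]
      by (auto simp: vert_def crosses_def)
    from crossing_subinterval[OF c\<Phi> \<open>a \<le> b\<close> \<open>lo < hi\<close> this]
    obtain a1 b1 where 1: "a \<le> a1" "a1 \<le> b1" "b1 \<le> b" "(\<lambda>t. \<Phi> (\<gamma> t)) ` {a1..b1} \<subseteq> {lo..hi}"
      "(\<Phi> (\<gamma> a1) = lo \<and> \<Phi> (\<gamma> b1) = hi) \<or> (\<Phi> (\<gamma> a1) = hi \<and> \<Phi> (\<gamma> b1) = lo)" by metis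
    have R1: "\<gamma> t \<in> R" if "t \<in> {a1..b1}" for t using that 1 \<gamma>R by auto
    have cQ: "continuous_on {a1..b1} (\<lambda>t. Q (\<gamma> t))"
      using 1 R1 by (intro continuous_on_compose2[OF cont(2) continuous_on_subset[OF c\<gamma>]]) auto
    \<comment> \<open>At one end of the arc \<open>\<Phi>\<close> equals \<open>\<theta>\<close>, at
      the other it equals \<open>\<theta> - l\<close> or \<open>\<theta> + l\<close>; hence
      \<open>Q\<close> maps the ends to opposite sides of the strip.\<close>
    have "crosses (\<lambda>t. snd (Q (\<gamma> t))) a1 b1 y z"
      using 1 R1[of a1] R1[of b1] mid[of "\<gamma> a1"] mid[of "\<gamma> b1"] sides[of "\<gamma> a1"] sides[of "\<gamma> b1"]
      by (auto simp: lo_def hi_def crosses_def split: if_splits)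
    from crossing_subinterval[OF continuous_on_snd[OF cQ] \<open>a1 \<le> b1\<close> \<open>y < z\<close> this]
    obtain a2 b2 where 2: "a1 \<le> a2" "a2 \<le> b2" "b2 \<le> b1"
      "(\<lambda>t. snd (Q (\<gamma> t))) ` {a2..b2} \<subseteq> {y..z}"
      "(snd (Q (\<gamma> a2)) = y \<and> snd (Q (\<gamma> b2)) = z) \<or> (snd (Q (\<gamma> a2)) = z \<and> snd (Q (\<gamma> b2)) = y)"
      by metis
    \<comment> \<open>The strict inequalities in \<open>M0\<close> and \<open>M1\<close> hold
      because \<open>Q\<close> would throw a point on the boundary of the band out of the
      strip.\<close>
    have "\<gamma> t \<in> (if i = 0 then M0 else M1)" if t: "t \<in> {a2..b2}" for t
    proof -
      have "t \<in> {a1..b1}" using t 2 by auto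
      then have "\<gamma> t \<in> R" "\<Phi> (\<gamma> t) \<in> {lo..hi}" using R1 1(4) by blast+
      moreover have "snd (Q (\<gamma> t)) \<in> {y..z}" using t 2(4) by blast
      then have "\<Phi> (\<gamma> t) \<noteq> \<theta> \<and> \<Phi> (\<gamma> t) \<noteq> \<theta> - l \<and> \<Phi> (\<gamma> t) \<noteq> \<theta> + l"
        using mid[of "\<gamma> t"] sides[of "\<gamma> t"] \<open>\<gamma> t \<in> R\<close> by auto
      ultimately show ?thesis by (auto simp: M0 M1 lo_def hi_def)
    qed
    moreover have "Q (\<gamma> t) \<in> R" if t: "t \<in> {a2..b2}" for t
    proof -
      have "snd (Q (\<gamma> t)) \<in> {y..z}" using t 2(4) by blast
      moreover have "fst (Q (\<gamma> t)) \<in> {-\<alpha>..\<alpha>}" using t 2 R1[of t] fst_Q[of "\<gamma> t"] by auto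
      ultimately show ?thesis by (metis R mem_Times_iff)
    qed
    then have "vert (\<lambda>t. Q (\<gamma> t)) a2 b2"
      using 2 by (auto simp: vert_def crosses_def intro: continuous_on_subset[OF cQ])
    ultimately show ?thesis using 1 2 by (intro exI[of _ a2] exI[of _ b2]) auto
  qed
  \<comment> \<open>All curves are iterates of the one vertical segment over \<open>0\<close>, with
    the initial height as common parameter.\<close>
  define \<gamma> where "\<gamma> n t = (Q ^^ n) (0, t)" for n and t :: real
  have \<gamma>_Suc: "\<gamma> (Suc n) = (\<lambda>t. Q (\<gamma> n t))" for n by (auto simp: \<gamma>_def)
  have "\<exists>I. \<forall>n. vert (\<gamma> n) (fst (I n)) (snd (I n)) \<and> (fst (I n) \<le> fst (I (Suc n)) \<and>
    snd (I (Suc n)) \<le> snd (I n) \<and>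
    \<gamma> n ` {fst (I (Suc n))..snd (I (Suc n))} \<subseteq> (if s n = 0 then M0 else M1))"
  proof (rule dependent_nat_choice)
    have "vert (\<gamma> 0) y z"
      using ab by (auto simp: vert_def \<gamma>_def R crosses_def intro!: continuous_intros)
    then show "\<exists>I. vert (\<gamma> 0) (fst I) (snd I)" by auto
  next
    fix I n assume "vert (\<gamma> n) (fst I) (snd I)"
    from step[OF this, of "s n"] show "\<exists>I'. vert (\<gamma> (Suc n)) (fst I') (snd I') \<and> fst I \<le> fst I' \<and>
      snd I' \<le> snd I \<and> \<gamma> n ` {fst I'..snd I'} \<subseteq> (if s n = 0 then M0 else M1)"
      unfolding \<gamma>_Suc by fastforce
  qed
  then obtain I where I: "\<And>n. vert (\<gamma> n) (fst (I n)) (snd (I n))"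
    "\<And>n. fst (I n) \<le> fst (I (Suc n))" "\<And>n. snd (I (Suc n)) \<le> snd (I n)"
    "\<And>n. \<gamma> n ` {fst (I (Suc n))..snd (I (Suc n))} \<subseteq> (if s n = 0 then M0 else M1)" by metis
  have inc: "incseq (\<lambda>n. fst (I n))" and dec: "decseq (\<lambda>n. snd (I n))"
    using I(2,3) by (auto intro: incseq_SucI decseq_SucI)
  have "(\<Inter>n. {fst (I n)..snd (I n)}) \<noteq> {}"
  proof (rule compact_nest)
    show "{fst (I n)..snd (I n)} \<noteq> {}" for n using I(1)[of n] by (auto simp: vert_def)
    show "{fst (I n)..snd (I n)} \<subseteq> {fst (I m)..snd (I m)}" if "m \<le> n" for m n
      using incseqD[OF inc that] decseqD[OF dec that] by auto
  qed auto
  then obtain t where "t \<in> (\<Inter>n. {fst (I n)..snd (I n)})" by blast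
  then have t: "t \<in> {fst (I n)..snd (I n)}" for n by blast
  show ?thesis
  proof (intro exI[of _ "\<lambda>n. \<gamma> n t"] conjI allI)
    show "\<gamma> (Suc n) t = Q (\<gamma> n t)" for n by (simp add: \<gamma>_Suc)
    \<comment> \<open>The symbol with index \<open>n\<close> is enforced by the interval with index
      \<open>Suc n\<close>.\<close>
    show "\<gamma> n t \<in> (if s n = 0 then M0 else M1)" for n using I(4)[of n] t[of "Suc n"] by blast
  qed
qed

subsection \<open>Flows close to a linear saddle focus\<close>

lemma PL_nth [simp]: "PL x $ 1 = x $ 1" "PL x $ 2 = x $ 2" "PL x $ 3 = 0"
  by (auto simp: PL_def)

lemma PU_nth [simp]: "PU x $ 1 = 0" "PU x $ 2 = 0" "PU x $ 3 = x $ 3"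
  by (auto simp: PU_def)

lemma vec3_eq_iff: "x = y \<longleftrightarrow> x $ 1 = y $ 1 \<and> x $ 2 = y $ 2 \<and> x $ 3 = (y $ 3 :: real)"
  for x y :: "real^3"
  by (auto simp: vec_eq_iff forall_3)

lemma norm_PL: "norm (PL x) = sqrt ((x $ 1)\<^sup>2 + (x $ 2)\<^sup>2)"
  by (simp add: norm_vec_def L2_set_def sum_3)

lemma norm_PL_le: "norm (PL x) \<le> norm x"
  unfolding norm_PL by (simp add: norm_vec_def L2_set_def sum_3)

lemma norm_PU: "norm (PU x) = \<bar>x $ 3\<bar>"
  by (simp add: norm_vec_def L2_set_def sum_3)

lemma bounded_linear_PL: "bounded_linear PL"
  by (intro bounded_linearI' linearI) (auto simp: vec3_eq_iff)

lemma continuous_on_PL [continuous_intros]: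
  "continuous_on S f \<Longrightarrow> continuous_on S (\<lambda>x. PL (f x))"
  using bounded_linear.continuous_on[OF bounded_linear_PL] .

lemma B1_iff: "x \<in> B1 \<longleftrightarrow> norm (PL x) \<le> 1 \<and> \<bar>x $ 3\<bar> \<le> 1"
  by (auto simp: B1_def norm_PU)

text \<open>The errors in \<open>third\<close> and \<open>planar\<close> are proportional to the
  respective component of \<open>x\<close>, not merely to the norm of \<open>x\<close>; this makes
  the estimates multiplicative along orbits. The number \<open>m\<close> measures the logarithmic
  error of one step.\<close>

locale near_linear_flow =
  fixes G :: "real \<Rightarrow> real^3 \<Rightarrow> real^3" and \<sigma> u \<eta> m :: real
  assumes flow: "is_flow G"
    and cont: "continuous_on UNIV (\<lambda>(t, x). G t x)"
    and third: "\<And>t x. t \<in> {0..1} \<Longrightarrow> x \<in> B1 \<Longrightarrow> \<bar>G t x $ 3 - exp (u * t) * x $ 3\<bar> \<le> \<eta> * \<bar>x $ 3\<bar>"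
    and planar: "\<And>t x. t \<in> {0..1} \<Longrightarrow> x \<in> B1 \<Longrightarrow>
      \<bar>norm (PL (G t x)) - exp (\<sigma> * t) * norm (PL x)\<bar> \<le> \<eta> * norm (PL x)"
    and \<sigma>_neg: "\<sigma> < 0" and u_pos: "0 < u"
    and \<eta>: "0 < \<eta>" "\<eta> < exp \<sigma>" "1 + \<eta> * exp (-\<sigma>) < exp (-\<sigma> / 2)"
    and m: "1 + \<eta> * exp (-\<sigma>) \<le> exp m" "exp (-m) \<le> 1 - \<eta> * exp (-\<sigma>)" "m < u"
begin

section \<open>Growth and decay along orbits\<close>

lemma m_pos: "0 < m"
proof -
  have "1 < exp m" using m(1) \<eta>(1) by (smt (verit) exp_gt_zero mult_pos_pos)
  then show ?thesis by simp
qed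

text \<open>Since \<open>exp (q * t)\<close> is at least \<open>exp \<sigma>\<close>, the additive
  error \<open>\<eta>\<close> is at most the fraction \<open>\<eta> * exp (-\<sigma>)\<close> of it
  and is absorbed by a factor \<open>exp m\<close>. It serves for both rates,
  \<open>q = \<sigma>\<close> and \<open>q = u\<close>.\<close>

lemma step_exponentials:
  assumes "\<sigma> \<le> q" "t \<in> {0..1}"
  shows "exp (q * t - m) \<le> exp (q * t) - \<eta>" "exp (q * t) + \<eta> \<le> exp (q * t + m)"
proof -
  have "\<sigma> \<le> \<sigma> * t" using assms \<sigma>_neg by (simp add: mult_le_cancel_left1)
  also have "\<dots> \<le> q * t" using assms by (intro mult_right_mono) auto
  finally have "exp \<sigma> \<le> exp (q * t)" by simp
  then have "\<eta> * exp (-\<sigma>) * exp \<sigma> \<le> \<eta> * exp (-\<sigma>) * exp (q * t)"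
    using \<eta> by (intro mult_left_mono) auto
  then have *: "\<eta> \<le> \<eta> * exp (-\<sigma>) * exp (q * t)"
    by (simp add: mult.assoc flip: exp_add)
  have "exp (q * t - m) = exp (- m) * exp (q * t)" by (simp flip: exp_add)
  also have "\<dots> \<le> (1 - \<eta> * exp (-\<sigma>)) * exp (q * t)" using m(2) by (intro mult_right_mono) auto
  also have "\<dots> \<le> exp (q * t) - \<eta>" using * by (simp add: algebra_simps)
  finally show "exp (q * t - m) \<le> exp (q * t) - \<eta>" .
  have "exp (q * t) + \<eta> \<le> (1 + \<eta> * exp (-\<sigma>)) * exp (q * t)" using * by (simp add: algebra_simps)
  also have "\<dots> \<le> exp m * exp (q * t)" using m(1) by (intro mult_right_mono) auto
  also have "\<dots> = exp (q * t + m)" by (simp flip: exp_add)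
  finally show "exp (q * t) + \<eta> \<le> exp (q * t + m)" .
qed

text \<open>The third bound is coarse but independent of \<open>t\<close>; it comes from
  \<open>\<eta> \<le> exp u\<close> and later keeps the exit time from being too short.\<close>

lemma step_third:
  assumes "t \<in> {0..1}" "x \<in> B1" "0 \<le> x $ 3"
  shows "x $ 3 * exp (u * t - m) \<le> G t x $ 3" "G t x $ 3 \<le> x $ 3 * exp (u * t + m)"
    "G t x $ 3 \<le> x $ 3 * exp (u + ln 2)"
proof -
  have 1: "x $ 3 * (exp (u * t) - \<eta>) \<le> G t x $ 3" "G t x $ 3 \<le> x $ 3 * (exp (u * t) + \<eta>)"
    using third[OF assms(1,2)] assms(3) by (auto simp: algebra_simps)
  have "\<sigma> \<le> u" using \<sigma>_neg u_pos by simp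
  note e = step_exponentials[OF this assms(1)]
  have "u * t \<le> u" using assms(1) u_pos by (simp add: mult_le_cancel_left2)
  then have "exp (u * t) \<le> exp u" by simp
  moreover have "exp \<sigma> \<le> exp u" using \<open>\<sigma> \<le> u\<close> by simp
  then have "\<eta> \<le> exp u" using \<eta>(2) by linarith
  ultimately have "exp (u * t) + \<eta> \<le> exp u * 2" by linarith
  then have e2: "exp (u * t) + \<eta> \<le> exp (u + ln 2)" by (simp add: exp_add)
  show "x $ 3 * exp (u * t - m) \<le> G t x $ 3" "G t x $ 3 \<le> x $ 3 * exp (u * t + m)"
    "G t x $ 3 \<le> x $ 3 * exp (u + ln 2)"
    using 1 mult_left_mono[OF e(1) assms(3)] mult_left_mono[OF e(2) assms(3)]
      mult_left_mono[OF e2 assms(3)] by linarith+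
qed

text \<open>The last bound rests on \<open>exp \<sigma> + \<eta> \<le> exp (\<sigma> / 2)\<close>,
  the rewritten smallness condition on \<open>\<eta>\<close>; it prevents integer iterates from
  leaving \<open>B1\<close> sideways.\<close>

lemma step_planar:
  assumes "t \<in> {0..1}" "x \<in> B1"
  shows "norm (PL x) * exp (\<sigma> * t - m) \<le> norm (PL (G t x))"
    "norm (PL (G t x)) \<le> norm (PL x) * exp (\<sigma> * t + m)"
    "norm (PL (G 1 x)) \<le> norm (PL x)"
proof -
  have 1: "norm (PL x) * (exp (\<sigma> * t) - \<eta>) \<le> norm (PL (G t x))"
    "norm (PL (G t x)) \<le> norm (PL x) * (exp (\<sigma> * t) + \<eta>)"
    using planar[OF assms(1,2)] by (auto simp: algebra_simps)
  note e = step_exponentials[OF order_refl assms(1)]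
  show "norm (PL x) * exp (\<sigma> * t - m) \<le> norm (PL (G t x))"
    "norm (PL (G t x)) \<le> norm (PL x) * exp (\<sigma> * t + m)"
    using 1 mult_left_mono[OF e(1), of "norm (PL x)"] mult_left_mono[OF e(2), of "norm (PL x)"]
    by auto
  have "exp \<sigma> + \<eta> = (1 + \<eta> * exp (-\<sigma>)) * exp \<sigma>"
    by (simp add: algebra_simps flip: exp_add)
  also have "\<dots> \<le> exp (-\<sigma> / 2) * exp \<sigma>" using \<eta>(3) by (intro mult_right_mono) auto
  also have "\<dots> = exp (\<sigma> / 2)" by (simp flip: exp_add)
  also have "\<dots> \<le> 1" using \<sigma>_neg by simp
  finally have "norm (PL x) * (exp \<sigma> + \<eta>) \<le> norm (PL x)"
    by (simp add: mult_left_le)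
  then show "norm (PL (G 1 x)) \<le> norm (PL x)"
    using planar[of 1 x] assms(2) by (simp add: algebra_simps)
qed

lemma G_0 [simp]: "G 0 x = x" and G_add: "G (t + s) x = G t (G s x)"
  using flow by (auto simp: is_flow_def)

text \<open>An orbit may leave \<open>B1\<close> between integer times, so the estimates are chained along unit
  steps, each of which costs one factor \<open>exp m\<close>.\<close>

lemma iterate_bounds:
  assumes x: "x \<in> B1" "0 < x $ 3" and le: "\<And>s. s \<in> {0..t} \<Longrightarrow> G s x $ 3 \<le> 1"
    and n: "real n \<le> t"
  shows "G n x \<in> B1 \<and> 0 < G n x $ 3 \<and>
    x $ 3 * exp (n * (u - m)) \<le> G n x $ 3 \<and> G n x $ 3 \<le> x $ 3 * exp (n * (u + m)) \<and>
    G n x $ 3 \<le> x $ 3 * exp (n * (u + ln 2)) \<and>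
    norm (PL x) * exp (n * (\<sigma> - m)) \<le> norm (PL (G n x)) \<and>
    norm (PL (G n x)) \<le> norm (PL x) * exp (n * (\<sigma> + m))"
  using n
proof (induction n)
  case 0
  then show ?case using x by auto
next
  case (Suc n)
  let ?y = "G n x"
  have IH: "?y \<in> B1" "0 < ?y $ 3" "x $ 3 * exp (n * (u - m)) \<le> ?y $ 3"
    "?y $ 3 \<le> x $ 3 * exp (n * (u + m))" "?y $ 3 \<le> x $ 3 * exp (n * (u + ln 2))"
    "norm (PL x) * exp (n * (\<sigma> - m)) \<le> norm (PL ?y)"
    "norm (PL ?y) \<le> norm (PL x) * exp (n * (\<sigma> + m))"
    using Suc by auto
  have eq: "G (Suc n) x = G 1 ?y" using G_add[of 1 n x] by (simp add: add.commute)
  have 1: "1 \<in> {0..1::real}" by simp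
  have exps: "exp (real (Suc n) * q) = exp (real n * q) * exp q" for q :: real
    by (simp add: algebra_simps flip: exp_add)
  note s = step_third[OF 1 IH(1) less_imp_le[OF IH(2)], unfolded mult_1_right]
    step_planar[OF 1 IH(1), unfolded mult_1_right]
  \<comment> \<open>The next iterate is again in \<open>B1\<close>: its height is controlled by
    \<open>le\<close>, its distance from the axis by the last bound of
    \<open>step_planar\<close>.\<close>
  have "0 < G 1 ?y $ 3"
    using s(1) mult_pos_pos[OF IH(2) exp_gt_zero[of "u - m"]] by linarith
  moreover have "G 1 ?y $ 3 \<le> 1" using le[of "Suc n"] Suc.prems eq by simp
  moreover have "norm (PL (G 1 ?y)) \<le> 1" using s(6) IH(1) by (auto simp: B1_iff)
  ultimately have B: "G 1 ?y \<in> B1" "0 < G 1 ?y $ 3" by (auto simp: B1_iff)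
  have "x $ 3 * exp (n * (u - m)) * exp (u - m) \<le> G 1 ?y $ 3"
    using s(1) mult_right_mono[OF IH(3) exp_ge_zero[of "u - m"]] by linarith
  moreover have "G 1 ?y $ 3 \<le> x $ 3 * exp (n * (u + m)) * exp (u + m)"
    using s(2) mult_right_mono[OF IH(4) exp_ge_zero[of "u + m"]] by linarith
  moreover have "G 1 ?y $ 3 \<le> x $ 3 * exp (n * (u + ln 2)) * exp (u + ln 2)"
    using s(3) mult_right_mono[OF IH(5) exp_ge_zero[of "u + ln 2"]] by linarith
  moreover have "norm (PL x) * exp (n * (\<sigma> - m)) * exp (\<sigma> - m) \<le> norm (PL (G 1 ?y))"
    using s(4) mult_right_mono[OF IH(6) exp_ge_zero[of "\<sigma> - m"]] by linarith
  moreover have "norm (PL (G 1 ?y)) \<le> norm (PL x) * exp (n * (\<sigma> + m)) * exp (\<sigma> + m)"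
    using s(5) mult_right_mono[OF IH(7) exp_ge_zero[of "\<sigma> + m"]] by linarith
  ultimately show ?case
    using B by (simp only: eq exps mult.assoc)
qed

text \<open>The orbit is cut into \<lfloor>t\<rfloor> unit steps and one step of length
  \<open>s\<close>. These are at most \<open>t + 1\<close> steps, whence the error
  \<open>(t + 1) * m\<close>.\<close>

lemma orbit_bounds:
  assumes x: "x \<in> B1" "0 < x $ 3" and t: "0 \<le> t" and le: "\<And>s. s \<in> {0..t} \<Longrightarrow> G s x $ 3 \<le> 1"
  shows "x $ 3 * exp (u * t - (t + 1) * m) \<le> G t x $ 3"
    "G t x $ 3 \<le> x $ 3 * exp (u * t + (t + 1) * m)"
    "G t x $ 3 \<le> x $ 3 * exp ((t + 1) * (u + ln 2))"
    "norm (PL x) * exp (\<sigma> * t - (t + 1) * m) \<le> norm (PL (G t x))"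
    "norm (PL (G t x)) \<le> norm (PL x) * exp (\<sigma> * t + (t + 1) * m)"
proof -
  define n where "n = nat \<lfloor>t\<rfloor>"
  define s where "s = t - n"
  have n: "real n \<le> t" and s: "s \<in> {0..1}" using t by (auto simp: n_def s_def) linarith
  let ?y = "G n x"
  have I: "?y \<in> B1" "0 < ?y $ 3" "x $ 3 * exp (n * (u - m)) \<le> ?y $ 3"
    "?y $ 3 \<le> x $ 3 * exp (n * (u + m))" "?y $ 3 \<le> x $ 3 * exp (n * (u + ln 2))"
    "norm (PL x) * exp (n * (\<sigma> - m)) \<le> norm (PL ?y)"
    "norm (PL ?y) \<le> norm (PL x) * exp (n * (\<sigma> + m))"
    using iterate_bounds[OF x le n] by auto
  have eq: "G t x = G s ?y" using G_add[of s n x] by (simp add: s_def)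
  note st = step_third[OF s I(1)] step_planar[OF s I(1)]
  have nm: "(n + 1) * m \<le> (t + 1) * m" using n m_pos by (intro mult_right_mono) auto
  have "exp (u * t - (t + 1) * m) \<le> exp (n * (u - m)) * exp (u * s - m)"
    using nm by (simp add: s_def algebra_simps flip: exp_add)
  then have "x $ 3 * exp (u * t - (t + 1) * m) \<le> x $ 3 * exp (n * (u - m)) * exp (u * s - m)"
    using x(2) by (simp add: mult.assoc)
  also have "\<dots> \<le> ?y $ 3 * exp (u * s - m)" using I(3) by (intro mult_right_mono) auto
  finally show "x $ 3 * exp (u * t - (t + 1) * m) \<le> G t x $ 3" using st(1) I(2) eq by simp
  have "?y $ 3 * exp (u * s + m) \<le> x $ 3 * exp (n * (u + m)) * exp (u * s + m)"
    using I(4) by (intro mult_right_mono) auto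
  also have "exp (n * (u + m)) * exp (u * s + m) \<le> exp (u * t + (t + 1) * m)"
    using nm by (simp add: s_def algebra_simps flip: exp_add)
  then have "x $ 3 * exp (n * (u + m)) * exp (u * s + m) \<le> x $ 3 * exp (u * t + (t + 1) * m)"
    using x(2) by (simp add: mult.assoc)
  finally show "G t x $ 3 \<le> x $ 3 * exp (u * t + (t + 1) * m)" using st(2) I(2) eq by simp
  have "?y $ 3 * exp (u + ln 2) \<le> x $ 3 * exp (n * (u + ln 2)) * exp (u + ln 2)"
    using I(5) by (intro mult_right_mono) auto
  also have "(n + 1) * (u + ln 2) \<le> (t + 1) * (u + ln 2)"
    using n u_pos by (intro mult_right_mono) auto
  then have "exp (n * (u + ln 2)) * exp (u + ln 2) \<le> exp ((t + 1) * (u + ln 2))"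
    by (simp add: algebra_simps flip: exp_add)
  then have "x $ 3 * exp (n * (u + ln 2)) * exp (u + ln 2) \<le> x $ 3 * exp ((t + 1) * (u + ln 2))"
    using x(2) by (simp add: mult.assoc)
  finally show "G t x $ 3 \<le> x $ 3 * exp ((t + 1) * (u + ln 2))" using st(3) I(2) eq by simp
  have "exp (\<sigma> * t - (t + 1) * m) \<le> exp (n * (\<sigma> - m)) * exp (\<sigma> * s - m)"
    using nm by (simp add: s_def algebra_simps flip: exp_add)
  then have "norm (PL x) * exp (\<sigma> * t - (t + 1) * m) \<le>
      norm (PL x) * exp (n * (\<sigma> - m)) * exp (\<sigma> * s - m)"
    by (simp add: mult.assoc mult_left_mono)
  also have "\<dots> \<le> norm (PL ?y) * exp (\<sigma> * s - m)" using I(6) by (intro mult_right_mono) auto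
  finally show "norm (PL x) * exp (\<sigma> * t - (t + 1) * m) \<le> norm (PL (G t x))" using st(4) eq by simp
  have "norm (PL ?y) * exp (\<sigma> * s + m) \<le> norm (PL x) * exp (n * (\<sigma> + m)) * exp (\<sigma> * s + m)"
    using I(7) by (intro mult_right_mono) auto
  also have "exp (n * (\<sigma> + m)) * exp (\<sigma> * s + m) \<le> exp (\<sigma> * t + (t + 1) * m)"
    using nm by (simp add: s_def algebra_simps flip: exp_add)
  then have "norm (PL x) * exp (n * (\<sigma> + m)) * exp (\<sigma> * s + m) \<le>
      norm (PL x) * exp (\<sigma> * t + (t + 1) * m)"
    by (simp add: mult.assoc mult_left_mono)
  finally show "norm (PL (G t x)) \<le> norm (PL x) * exp (\<sigma> * t + (t + 1) * m)" using st(5) eq by simp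
qed

section \<open>Existence and uniqueness of the exit time\<close>

lemma continuous_on_G [continuous_intros]:
  assumes "continuous_on S f" "continuous_on S g"
  shows "continuous_on S (\<lambda>x. G (f x) (g x))"
  using continuous_on_compose2[OF cont continuous_on_Pair[OF assms]] by simp

text \<open>As long as the height stays below 1 it grows at least at the positive rate
  \<open>u - m\<close>, so it must reach 1; the first such time is the exit time. The lower orbit
  bound keeps the height positive before it.\<close>

lemma ex_exit_time:
  assumes x: "x \<in> B1" "0 < x $ 3" "x $ 3 < 1"
  obtains \<tau> where "0 < \<tau>" "\<And>s. s \<in> {0..<\<tau>} \<Longrightarrow> 0 < G s x $ 3 \<and> G s x $ 3 < 1" "G \<tau> x $ 3 = 1"
proof -
  have c: "continuous_on S (\<lambda>s. G s x $ 3)" for S by (intro continuous_intros)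
  have "\<exists>t\<ge>0. 1 \<le> G t x $ 3"
  proof (rule ccontr)
    assume "\<not> ?thesis"
    then have lt: "G t x $ 3 < 1" if "0 \<le> t" for t using that by force
    obtain n :: nat where "ln (1 / x $ 3) / (u - m) < n" using reals_Archimedean2 by blast
    then have "ln (1 / x $ 3) < n * (u - m)" using m(3) by (simp add: field_simps)
    then have "1 / x $ 3 < exp (n * (u - m))"
      using x by (metis divide_pos_pos exp_less_mono exp_ln zero_less_one)
    then have "1 < x $ 3 * exp (n * (u - m))" using x by (simp add: field_simps)
    moreover have "x $ 3 * exp (n * (u - m)) \<le> G n x $ 3"
      using iterate_bounds[OF x(1,2), of n n] lt by (auto intro: less_imp_le)
    ultimately show False using lt[of n] by simp
  qed
  then obtain t where t: "0 \<le> t" "1 \<le> G t x $ 3" by blast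
  obtain a b where ab: "0 \<le> a" "a \<le> b" "b \<le> t" "G b x $ 3 = 1"
    using IVT'[of "\<lambda>s. G s x $ 3" 0 1 t] t x c by auto
  define A where "A = {s \<in> {0..t}. G s x $ 3 = 1}"
  have neA: "A \<noteq> {}" using ab by (auto simp: A_def)
  have cA: "closed A"
    unfolding A_def using continuous_closed_preimage_constant[OF c, of "{0..t}"] by auto
  have bA: "bdd_below A" by (auto simp: A_def bdd_below_def)
  define \<tau> where "\<tau> = Inf A"
  have \<tau>: "\<tau> \<in> A" unfolding \<tau>_def by (rule closed_contains_Inf[OF neA bA cA])
  have pos: "0 < \<tau>" using \<tau> x by (cases "\<tau> = 0") (auto simp: A_def)
  have lt: "G s x $ 3 < 1" if s: "s \<in> {0..<\<tau>}" for s
  proof (rule ccontr)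
    assume "\<not> G s x $ 3 < 1"
    then obtain s' where "0 \<le> s'" "s' \<le> s" "G s' x $ 3 = 1"
      using IVT'[of "\<lambda>s. G s x $ 3" 0 1 s] s x c by auto
    then have "s' \<in> A" using s \<tau> by (auto simp: A_def)
    then have "\<tau> \<le> s'" unfolding \<tau>_def by (rule cInf_lower[OF _ bA])
    then show False using \<open>s' \<le> s\<close> s by auto
  qed
  have "0 < G s x $ 3" if s: "s \<in> {0..<\<tau>}" for s
  proof -
    have "x $ 3 * exp (u * s - (s + 1) * m) \<le> G s x $ 3"
      using s lt by (intro orbit_bounds(1)[OF x(1,2)]) (auto intro: less_imp_le)
    then show ?thesis using x(2) by (smt (verit) exp_gt_zero mult_pos_pos)
  qed
  then show thesis using that[of \<tau>] pos lt \<tau> by (auto simp: A_def)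
qed

lemma exit_time:
  assumes x: "x \<in> B1" "0 < x $ 3" "x $ 3 < 1"
  shows "0 < exit_time G x" "\<And>s. s \<in> {0..<exit_time G x} \<Longrightarrow> 0 < G s x $ 3 \<and> G s x $ 3 < 1"
    "G (exit_time G x) x $ 3 = 1" "\<And>s. s \<in> {0..exit_time G x} \<Longrightarrow> G s x $ 3 \<le> 1"
proof -
  obtain \<tau> where \<tau>: "0 < \<tau>" "\<And>s. s \<in> {0..<\<tau>} \<Longrightarrow> 0 < G s x $ 3 \<and> G s x $ 3 < 1" "G \<tau> x $ 3 = 1"
    using ex_exit_time[OF x] by blast
  have eq: "exit_time G x = \<tau>"
    unfolding exit_time_def
  proof (rule the_equality)
    fix \<tau>' assume *: "0 < \<tau>' \<and> (\<forall>s. 0 \<le> s \<and> s < \<tau>' \<longrightarrow> 0 < G s x $ 3 \<and> G s x $ 3 < 1) \<and> G \<tau>' x $ 3 = 1"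
    show "\<tau>' = \<tau>"
    proof (rule linorder_cases[of \<tau>' \<tau>])
      assume "\<tau>' < \<tau>" then show ?thesis using \<tau>(2)[of \<tau>'] * by auto
    next
      assume "\<tau> < \<tau>'" then show ?thesis using \<tau>(1,3) * by (metis less_eq_real_def less_irrefl)
    qed auto
  qed (use \<tau> in auto)
  show "0 < exit_time G x" "G (exit_time G x) x $ 3 = 1"
    and *: "\<And>s. s \<in> {0..<exit_time G x} \<Longrightarrow> 0 < G s x $ 3 \<and> G s x $ 3 < 1"
    using \<tau> eq by auto
  show "G s x $ 3 \<le> 1" if "s \<in> {0..exit_time G x}" for s
    using that \<tau> eq by (cases "s = \<tau>") (auto intro: less_imp_le)
qed

end

section \<open>Exit radius and continuity of the exit time\<close>

lemma MI_imp_B1: "x \<in> MI \<Longrightarrow> 0 \<le> x $ 3 \<Longrightarrow> x $ 3 \<le> 1 \<Longrightarrow> x \<in> B1"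
  by (auto simp: MI_def B1_iff)

context near_linear_flow
begin

text \<open>With \<open>y = ln (1 / x $ 3)\<close>, the height bounds place the exit time between
  \<open>y / (u + \<eta>')\<close> and \<open>y / (u - \<eta>')\<close>; inserting this into the
  planar bounds at the exit gives powers of the initial height.\<close>

lemma radius_bounds:
  assumes x: "x \<in> MI" "0 < x $ 3" "x $ 3 < d" "d < 1"
    and \<eta>': "m < \<eta>'" "\<eta>' < u" "\<sigma> + \<eta>' < 0"
    and d: "1 / (u + ln 2) * ln (1 / d) - 1 > m / (\<eta>' - m)"
  shows "x $ 3 powr ((-\<sigma> + \<eta>') / (u - \<eta>')) \<le> norm (PL (inner_map G x))"
    "norm (PL (inner_map G x)) \<le> x $ 3 powr ((-\<sigma> - \<eta>') / (u + \<eta>'))"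
proof -
  define \<tau> where "\<tau> = exit_time G x"
  have B: "x \<in> B1" using x by (intro MI_imp_B1) auto
  have norm_x: "norm (PL x) = 1" using x(1) by (simp add: MI_def)
  have "x $ 3 < 1" using x by simp
  note ex = exit_time[OF B x(2) this, folded \<tau>_def]
  note ob = orbit_bounds[OF B x(2) less_imp_le[OF ex(1)] ex(4), unfolded ex(3) norm_x mult_1]
  define y where "y = ln (1 / x $ 3)"
  have x3: "x $ 3 = exp (- y)" using x(2) by (simp add: y_def ln_div)
  have y: "ln (1 / d) < y" using x by (simp add: y_def ln_div)
  have "0 \<le> - y + (\<tau> + 1) * (u + ln 2)"
    using ob(3) by (simp add: x3 flip: exp_add)
  moreover have uln: "0 < u + ln 2" using u_pos by (simp add: add_pos_pos)
  ultimately have "1 / (u + ln 2) * y \<le> \<tau> + 1" by (simp add: pos_divide_le_eq)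
  moreover have "1 / (u + ln 2) * ln (1 / d) < 1 / (u + ln 2) * y"
    using y uln by (intro mult_strict_left_mono) auto
  ultimately have "m / (\<eta>' - m) < \<tau>" using d by linarith
  then have err: "(\<tau> + 1) * m \<le> \<eta>' * \<tau>" using \<eta>'(1) by (simp add: field_simps)
  have "0 \<le> - y + (u * \<tau> + (\<tau> + 1) * m)" "- y + (u * \<tau> - (\<tau> + 1) * m) \<le> 0"
    using ob(1,2) by (simp_all add: x3 flip: exp_add)
  then have "y \<le> (u + \<eta>') * \<tau>" "(u - \<eta>') * \<tau> \<le> y" using err by (auto simp: algebra_simps)
  then have \<tau>: "y / (u + \<eta>') \<le> \<tau>" "\<tau> \<le> y / (u - \<eta>')"
    using \<eta>' m_pos u_pos by (auto simp: field_simps)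
  have powr: "x $ 3 powr q = exp (- y * q)" for q by (simp add: x3 powr_def)
  have swap: "- y * (a / b) = - (a * (y / b))" for a b :: real
    by (simp only: mult_minus_left times_divide_eq_right times_divide_eq_left mult.commute)
  have "- y * ((-\<sigma> + \<eta>') / (u - \<eta>')) = - ((-\<sigma> + \<eta>') * (y / (u - \<eta>')))" by (rule swap)
  also have "\<dots> \<le> - ((-\<sigma> + \<eta>') * \<tau>)"
    using \<tau>(2) \<sigma>_neg m_pos \<eta>' by (intro le_imp_neg_le mult_left_mono) auto
  also have "\<dots> \<le> \<sigma> * \<tau> - (\<tau> + 1) * m" using err by (simp add: algebra_simps)
  finally have "x $ 3 powr ((-\<sigma> + \<eta>') / (u - \<eta>')) \<le> exp (\<sigma> * \<tau> - (\<tau> + 1) * m)"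
    unfolding powr by simp
  then show "x $ 3 powr ((-\<sigma> + \<eta>') / (u - \<eta>')) \<le> norm (PL (inner_map G x))"
    using ob(4) by (simp add: inner_map_def \<tau>_def)
  have "\<sigma> * \<tau> + (\<tau> + 1) * m \<le> - ((-\<sigma> - \<eta>') * \<tau>)" using err by (simp add: algebra_simps)
  also have "\<dots> \<le> - ((-\<sigma> - \<eta>') * (y / (u + \<eta>')))"
    using \<tau>(1) \<eta>' by (intro le_imp_neg_le mult_left_mono) auto
  also have "\<dots> = - y * ((-\<sigma> - \<eta>') / (u + \<eta>'))" by (rule swap[symmetric])
  finally have "exp (\<sigma> * \<tau> + (\<tau> + 1) * m) \<le> x $ 3 powr ((-\<sigma> - \<eta>') / (u + \<eta>'))"
    unfolding powr by simp
  then show "norm (PL (inner_map G x)) \<le> x $ 3 powr ((-\<sigma> - \<eta>') / (u + \<eta>'))"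
    using ob(5) by (simp add: inner_map_def \<tau>_def)
qed

text \<open>Gives a compact range for the exit time over starting heights bounded away from 0, as
  the closed-graph criterion for continuity demands.\<close>

lemma exit_time_le:
  assumes x: "x \<in> B1" "d \<le> x $ 3" "x $ 3 < 1" "0 < d"
  shows "exit_time G x \<le> (ln (1 / d) + m) / (u - m)"
proof -
  define \<tau> where "\<tau> = exit_time G x"
  have pos: "0 < x $ 3" using x by simp
  note ex = exit_time[OF x(1) pos x(3), folded \<tau>_def]
  note ob = orbit_bounds(1)[OF x(1) pos less_imp_le[OF ex(1)] ex(4), unfolded ex(3)]
  have "d * exp (u * \<tau> - (\<tau> + 1) * m) \<le> x $ 3 * exp (u * \<tau> - (\<tau> + 1) * m)"
    using x by (intro mult_right_mono) auto
  then have "d * exp (u * \<tau> - (\<tau> + 1) * m) \<le> 1" using ob by linarith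
  then have "exp (u * \<tau> - (\<tau> + 1) * m) \<le> exp (ln (1 / d))" using x by (simp add: field_simps)
  then have "u * \<tau> - (\<tau> + 1) * m \<le> ln (1 / d)" by simp
  then show ?thesis using m(3) by (simp add: \<tau>_def field_simps)
qed

text \<open>Otherwise the height would have an interior local maximum at the exit, and the velocity
  there would have zero third component.\<close>

lemma not_le_after_exit:
  assumes x: "x \<in> B1" "0 < x $ 3" "x $ 3 < 1"
    and diff: "(\<lambda>t. G t (inner_map G x)) differentiable (at 0)"
    and trans: "vector_derivative (\<lambda>t. G t (inner_map G x)) (at 0) \<notin> Lsp"
    and t: "exit_time G x < t"
  shows "\<exists>s\<in>{0..t}. 1 < G s x $ 3"
proof (rule ccontr)
  assume "\<not> ?thesis"
  then have le: "G s x $ 3 \<le> 1" if "s \<in> {0..t}" for s using that by force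
  define \<tau> where "\<tau> = exit_time G x"
  define y where "y = inner_map G x"
  let ?D = "vector_derivative (\<lambda>t. G t y) (at 0)"
  note ex = exit_time[OF x, folded \<tau>_def]
  have G_y: "G s y = G (s + \<tau>) x" for s
    by (simp add: y_def inner_map_def \<tau>_def G_add)
  have "((\<lambda>s. G s y) has_vector_derivative ?D) (at 0)"
    using diff by (simp add: y_def flip: vector_derivative_works)
  then have "((\<lambda>s. G s y $ 3) has_vector_derivative ?D $ 3) (at 0)"
    by (rule bounded_linear.has_vector_derivative[OF bounded_linear_vec_nth])
  then have "DERIV (\<lambda>s. G s y $ 3) 0 :> ?D $ 3"
    by (simp add: has_real_derivative_iff_has_vector_derivative)
  then have "?D $ 3 = 0"
  proof (rule DERIV_local_max)
    show "0 < min \<tau> (t - \<tau>)" using ex(1) t by (simp add: \<tau>_def)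
    show "\<forall>s. \<bar>0 - s\<bar> < min \<tau> (t - \<tau>) \<longrightarrow> G s y $ 3 \<le> G 0 y $ 3"
    proof (intro allI impI)
      fix s assume s: "\<bar>0 - s\<bar> < min \<tau> (t - \<tau>)"
      then have "s + \<tau> \<in> {0..t}" by (auto simp: abs_less_iff)
      from le[OF this] show "G s y $ 3 \<le> G 0 y $ 3" using ex(3) G_y[of 0] G_y[of s] by simp
    qed
  qed
  then show False using trans by (simp add: Lsp_iff y_def)
qed

text \<open>Transversality at the exit makes the graph of the exit time closed: a limit of exit
  points cannot be a later visit to the plane at height 1.\<close>

lemma continuous_on_exit_time:
  assumes S: "closed S" "S \<subseteq> B1" "\<And>x. x \<in> S \<Longrightarrow> d \<le> x $ 3 \<and> x $ 3 < 1" "0 < d"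
    and diff: "\<And>x. x \<in> S \<Longrightarrow> (\<lambda>t. G t (inner_map G x)) differentiable (at 0)"
    and trans: "\<And>x. x \<in> S \<Longrightarrow> vector_derivative (\<lambda>t. G t (inner_map G x)) (at 0) \<notin> Lsp"
  shows "continuous_on S (exit_time G)"
proof -
  define M where "M = (ln (1 / d) + m) / (u - m)"
  have x: "x \<in> B1" "0 < x $ 3" "x $ 3 < 1" if "x \<in> S" for x using S that by force+
  have M: "exit_time G \<in> S \<rightarrow> {0..M}"
    using exit_time_le[of _ d] S x exit_time(1) by (auto simp: M_def intro!: less_imp_le)
  let ?K = "S \<times> {0..M}"
  have c: "continuous_on ?K (\<lambda>p. G (r * snd p) (fst p) $ 3)" for r by (intro continuous_intros)
  \<comment> \<open>Writing intermediate times as \<open>r * t\<close> with \<open>r\<close> in the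
    unit interval expresses the bound on the whole orbit piece as an intersection of closed
    conditions over a fixed index set.\<close>
  have "closed ({p \<in> ?K. G (snd p) (fst p) $ 3 = 1} \<inter>
      (\<Inter>r\<in>{0..1}. {p \<in> ?K. G (r * snd p) (fst p) $ 3 \<in> {..1}}))"
    using c[of 1] c S(1)
    by (intro closed_Int closed_INT ballI continuous_closed_preimage_constant
        continuous_closed_preimage[unfolded vimage_def Int_def mem_Collect_eq]) (auto intro: closed_Times)
  also have "\<dots> = (\<lambda>x. (x, exit_time G x)) ` S"
  proof (intro equalityI subsetI)
    fix p assume p: "p \<in> {p \<in> ?K. G (snd p) (fst p) $ 3 = 1} \<inter>
      (\<Inter>r\<in>{0..1}. {p \<in> ?K. G (r * snd p) (fst p) $ 3 \<in> {..1}})"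
    obtain x t where p_eq: "p = (x, t)" by (cases p)
    have xt: "x \<in> S" "0 \<le> t" "G t x $ 3 = 1" "\<And>r. r \<in> {0..1} \<Longrightarrow> G (r * t) x $ 3 \<le> 1"
      using p p_eq by auto
    have "0 < t" using xt x[of x] by (cases "t = 0") auto
    \<comment> \<open>Times beyond the exit are excluded by transversality, times before it because
      the height is still less than 1.\<close>
    have "\<not> exit_time G x < t"
    proof
      assume "exit_time G x < t"
      from not_le_after_exit[OF x[OF xt(1)] diff[OF xt(1)] trans[OF xt(1)] this]
      obtain s where "s \<in> {0..t}" "1 < G s x $ 3" by blast
      then show False using xt(4)[of "s / t"] \<open>0 < t\<close> by auto
    qed
    moreover have "\<not> t < exit_time G x"
      using exit_time(2)[OF x[OF xt(1)], of t] xt by auto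
    ultimately show "p \<in> (\<lambda>x. (x, exit_time G x)) ` S" using xt(1) p_eq by auto
  next
    fix p assume "p \<in> (\<lambda>x. (x, exit_time G x)) ` S"
    then obtain x' where x': "x' \<in> S" "p = (x', exit_time G x')" by auto
    note ex = exit_time[OF x[OF x'(1)]]
    have "G (r * exit_time G x') x' $ 3 \<le> 1" if "r \<in> {0..1}" for r
      using that ex(1) by (intro ex(4)) (auto simp: mult_left_le_one_le)
    then show "p \<in> {p \<in> ?K. G (snd p) (fst p) $ 3 = 1} \<inter>
      (\<Inter>r\<in>{0..1}. {p \<in> ?K. G (r * snd p) (fst p) $ 3 \<in> {..1}})"
      using x' M ex(3) by auto
  qed
  finally show ?thesis
    using M by (intro continuous_from_closed_graph[of "{0..M}"]) auto
qed

end

section \<open>Lifting the angle along orbits\<close>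

lemma angle_lift_unique:
  fixes f g :: "real \<Rightarrow> real"
  assumes "continuous_on {a..b} f" "continuous_on {a..b} g" "a \<le> b" "f a = g a"
    and eq: "\<And>t. t \<in> {a..b} \<Longrightarrow> cos (f t) = cos (g t) \<and> sin (f t) = sin (g t)"
  shows "f b = g b"
proof -
  \<comment> \<open>The difference of two lifts takes values in the multiples of 2 pi, a discrete
    set, so continuity on an interval forces it to be constant.\<close>
  have "(\<lambda>t. f t - g t) constant_on {a..b}"
  proof (rule continuous_discrete_range_constant)
    show "continuous_on {a..b} (\<lambda>t. f t - g t)" by (intro continuous_intros assms)
    fix x assume x: "x \<in> {a..b}"
    have "2 * pi \<le> norm ((f y - g y) - (f x - g x))"
      if y: "y \<in> {a..b}" "f y - g y \<noteq> f x - g x" for y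
    proof -
      obtain n k :: int where "f x = g x + 2 * pi * n" "f y = g y + 2 * pi * k"
        using eq[OF x] eq[OF y(1)] sin_cos_eq_iff by metis
      then have *: "(f y - g y) - (f x - g x) = 2 * pi * of_int (k - n)"
        by (simp add: algebra_simps)
      then have "k - n \<noteq> 0" using y(2) by auto
      then have "1 \<le> \<bar>real_of_int (k - n)\<bar>" by linarith
      then have "2 * pi * 1 \<le> 2 * pi * \<bar>real_of_int (k - n)\<bar>" by (intro mult_left_mono) auto
      then show ?thesis by (simp add: * abs_mult)
    qed
    then show "\<exists>e>0. \<forall>y. y \<in> {a..b} \<and> f y - g y \<noteq> f x - g x \<longrightarrow> e \<le> norm (f y - g y - (f x - g x))"
      by (intro exI[of _ "2 * pi"]) auto
  qed auto
  then obtain c where "\<And>t. t \<in> {a..b} \<Longrightarrow> f t - g t = c" by (auto simp: constant_on_def)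
  from this[of a] this[of b] show ?thesis using assms by auto
qed

lemma cyl_nth [simp]: "cyl \<omega> p $ 1 = cos (\<omega> + fst p)" "cyl \<omega> p $ 2 = sin (\<omega> + fst p)"
  "cyl \<omega> p $ 3 = snd p"
  by (auto simp: cyl_def split_beta)

lemma continuous_on_vec3:
  fixes f :: "'a::topological_space \<Rightarrow> real^3"
  assumes "continuous_on S (\<lambda>x. f x $ 1)" "continuous_on S (\<lambda>x. f x $ 2)" "continuous_on S (\<lambda>x. f x $ 3)"
  shows "continuous_on S f"
  proof -
  have "continuous_on S (\<lambda>x. \<chi> i. f x $ i)"
    using assms by (intro continuous_on_vec_lambda) (metis exhaust_3)
  then show ?thesis by simp
qed

lemma cyl_mem_MI: "cyl \<omega> p \<in> MI"
  by (simp add: MI_def norm_PL)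

lemma continuous_on_cyl: "continuous_on S (cyl \<omega>)"
  by (rule continuous_on_vec3) (auto intro!: continuous_intros)

context near_linear_flow
begin

text \<open>Rescaling time to the unit interval turns the orbits into a map on the contractible set
  \<open>S \<times> {0..1}\<close>, where a continuous logarithm exists.\<close>

lemma angle_fun:
  assumes S: "convex S" and ex: "continuous_on S (\<lambda>p. exit_time G (cyl \<omega> p))"
    and ex_pos: "\<And>p. p \<in> S \<Longrightarrow> 0 < exit_time G (cyl \<omega> p)"
    and nz: "\<And>p t. p \<in> S \<Longrightarrow> t \<in> {0..exit_time G (cyl \<omega> p)} \<Longrightarrow> PL (G t (cyl \<omega> p)) \<noteq> 0"
  shows "continuous_on S (angle_fun G \<omega>)"
    "\<And>p. p \<in> S \<Longrightarrow> PL (inner_map G (cyl \<omega> p)) =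
      norm (PL (inner_map G (cyl \<omega> p))) *\<^sub>R vector [cos (angle_fun G \<omega> p), sin (angle_fun G \<omega> p), 0]"
proof -
  let ?\<tau> = "\<lambda>p. exit_time G (cyl \<omega> p)"
  let ?w = "\<lambda>q. G (snd q * ?\<tau> (fst q)) (cyl \<omega> (fst q))"
  define z where "z q = Complex (?w q $ 1) (?w q $ 2)" for q
  have c: "continuous_on (S \<times> {0..1}) (\<lambda>q. ?w q)"
    by (intro continuous_intros continuous_on_compose2[OF ex] continuous_on_compose2[OF continuous_on_cyl]) auto
  have cz: "continuous_on (S \<times> {0..1}) z"
    unfolding z_def by (intro continuous_intros c)
  have norm_z: "norm (z q) = norm (PL (?w q))" for q
    by (simp add: z_def cmod_def norm_PL)
  have mem: "s * ?\<tau> p \<in> {0..?\<tau> p}" if "p \<in> S" "s \<in> {0..1}" for p s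
    using that ex_pos[of p] by (auto simp: mult_left_le_one_le)
  have "z q \<noteq> 0" if "q \<in> S \<times> {0..1}" for q
    using norm_z[of q] nz[of "fst q"] mem[of "fst q" "snd q"] that by fastforce
  moreover have "contractible (S \<times> {0..1::real})"
    using S by (intro convex_imp_contractible convex_Times) auto
  ultimately obtain g where g: "continuous_on (S \<times> {0..1}) g" "\<And>q. q \<in> S \<times> {0..1} \<Longrightarrow> z q = exp (g q)"
    using continuous_logarithm_on_contractible[OF cz] by blast
  \<comment> \<open>Subtracting the imaginary part at \<open>s = 0\<close> makes the lift start at
    \<open>\<omega> + fst p\<close>. The shift is a multiple of 2 pi because the orbit starts at
    \<open>cyl \<omega> p\<close>.\<close>
  define \<Theta> where "\<Theta> p s = Im (g (p, s)) - Im (g (p, 0)) + (\<omega> + fst p)" for p s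
  have z_polar: "z q = norm (z q) * cis (Im (g q))" if "q \<in> S \<times> {0..1}" for q
    using g(2)[OF that] exp_eq_polar[of "g q"] norm_exp_eq_Re[of "g q"] by simp
  have w_\<Theta>: "PL (?w (p, s)) = norm (PL (?w (p, s))) *\<^sub>R vector [cos (\<Theta> p s), sin (\<Theta> p s), 0]"
    if p: "p \<in> S" "s \<in> {0..1}" for p s
  proof -
    have "norm (z (p, 0)) = 1" by (simp add: norm_z norm_PL)
    then have "cis (Im (g (p, 0))) = cis (\<omega> + fst p)"
      using z_polar[of "(p, 0)"] p by (simp add: z_def complex_eq_iff)
    then have "cis (\<Theta> p s) = cis (Im (g (p, s)))"
      unfolding \<Theta>_def cis_mult[symmetric] cis_divide[symmetric] by simp
    then have "z (p, s) = norm (PL (?w (p, s))) * cis (\<Theta> p s)"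
      using z_polar[of "(p, s)"] p norm_z[of "(p, s)"] by simp
    then show ?thesis by (simp add: z_def complex_eq_iff vec3_eq_iff)
  qed
  have angle: "angle_fun G \<omega> p = \<Theta> p 1" if p: "p \<in> S" for p
    unfolding angle_fun_def
  proof (rule the_equality)
    let ?T = "{0..?\<tau> p}"
    note \<tau> = ex_pos[OF p]
    have c\<Theta>: "continuous_on ?T (\<lambda>t. \<Theta> p (t / ?\<tau> p))"
      unfolding \<Theta>_def using p \<tau>
      by (intro continuous_intros continuous_on_compose2[OF g(1)]) auto
    have unit: "(1 / norm (PL (G t (cyl \<omega> p)))) *\<^sub>R PL (G t (cyl \<omega> p)) =
        vector [cos (\<Theta> p (t / ?\<tau> p)), sin (\<Theta> p (t / ?\<tau> p)), 0]" if t: "t \<in> ?T" for t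
    proof -
      have "t / ?\<tau> p \<in> {0..1}" using t \<tau> by auto
      from w_\<Theta>[OF p this]
      have eq: "PL (G t (cyl \<omega> p)) = norm (PL (G t (cyl \<omega> p))) *\<^sub>R
          vector [cos (\<Theta> p (t / ?\<tau> p)), sin (\<Theta> p (t / ?\<tau> p)), 0]" using \<tau> by simp
      have "(1 / r) *\<^sub>R y = z" if "y = r *\<^sub>R z" "r \<noteq> 0" for r and y z :: "real^3"
        using that by simp
      from this[OF eq] show ?thesis using nz[OF p t] by simp
    qed
    show "\<exists>\<theta>. continuous_on ?T \<theta> \<and> \<theta> 0 = \<omega> + fst p \<and>
      (\<forall>t\<in>?T. (1 / norm (PL (G t (cyl \<omega> p)))) *\<^sub>R PL (G t (cyl \<omega> p)) = vector [cos (\<theta> t), sin (\<theta> t), 0]) \<and>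
      \<Theta> p 1 = \<theta> (?\<tau> p)"
      using c\<Theta> unit \<tau> by (intro exI[of _ "\<lambda>t. \<Theta> p (t / ?\<tau> p)"]) (auto simp: \<Theta>_def)
    fix a assume "\<exists>\<theta>. continuous_on ?T \<theta> \<and> \<theta> 0 = \<omega> + fst p \<and>
      (\<forall>t\<in>?T. (1 / norm (PL (G t (cyl \<omega> p)))) *\<^sub>R PL (G t (cyl \<omega> p)) = vector [cos (\<theta> t), sin (\<theta> t), 0]) \<and>
      a = \<theta> (?\<tau> p)"
    then obtain \<theta> where \<theta>: "continuous_on ?T \<theta>" "\<theta> 0 = \<omega> + fst p" "a = \<theta> (?\<tau> p)"
      "\<And>t. t \<in> ?T \<Longrightarrow> (1 / norm (PL (G t (cyl \<omega> p)))) *\<^sub>R PL (G t (cyl \<omega> p)) = vector [cos (\<theta> t), sin (\<theta> t), 0]"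
      by blast
    have "\<theta> (?\<tau> p) = \<Theta> p (?\<tau> p / ?\<tau> p)"
    proof (rule angle_lift_unique[OF \<theta>(1) c\<Theta>])
      show "cos (\<theta> t) = cos (\<Theta> p (t / ?\<tau> p)) \<and> sin (\<theta> t) = sin (\<Theta> p (t / ?\<tau> p))" if "t \<in> ?T" for t
        using \<theta>(4)[OF that, unfolded unit[OF that]] by (simp add: vec3_eq_iff)
    qed (use \<tau> \<theta> in \<open>auto simp: \<Theta>_def\<close>)
    then show "a = \<Theta> p 1" using \<tau> \<theta>(3) by simp
  qed
  have "continuous_on S (\<lambda>p. \<Theta> p 1)"
    unfolding \<Theta>_def by (intro continuous_intros continuous_on_compose2[OF g(1)]) auto
  then show "continuous_on S (angle_fun G \<omega>)" using angle by (simp cong: continuous_on_cong)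
  fix p assume "p \<in> S"
  then show "PL (inner_map G (cyl \<omega> p)) =
      norm (PL (inner_map G (cyl \<omega> p))) *\<^sub>R vector [cos (angle_fun G \<omega> p), sin (angle_fun G \<omega> p), 0]"
    using w_\<Theta>[of p 1] by (simp add: angle inner_map_def)
qed

end

subsection \<open>Coordinates and rescaled flows\<close>

text \<open>Rotating by \<open>- \<omega>\<close> moves the excluded direction to -1, so the
  principal logarithm covers the whole chart. This explicit formula gives access to continuity and
  differentiability.\<close>

lemma cyl_inv_eq:
  assumes "z \<in> MI" "PL z \<noteq> - vector [cos \<omega>, sin \<omega>, 0]"
  defines "\<zeta> \<equiv> Complex (z $ 1) (z $ 2) * cis (- \<omega>)"
  shows "\<zeta> \<notin> \<real>\<^sub>\<le>\<^sub>0" "cyl_inv \<omega> z = (Im (Ln \<zeta>), z $ 3)"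
proof -
  have norm_\<zeta>: "norm \<zeta> = 1"
  proof -
    have "norm (Complex (z $ 1) (z $ 2)) = 1"
      using assms(1) by (simp add: MI_def norm_PL cmod_def)
    then show ?thesis by (simp add: \<zeta>_def norm_mult)
  qed
  have z: "Complex (z $ 1) (z $ 2) = \<zeta> * cis \<omega>"
    by (simp add: \<zeta>_def mult.assoc cis_mult)
  have "\<zeta> \<noteq> -1"
    using z assms(2) by (auto simp: complex_eq_iff vec3_eq_iff)
  then show \<zeta>: "\<zeta> \<notin> \<real>\<^sub>\<le>\<^sub>0"
    using norm_\<zeta> by (auto simp: complex_nonpos_Reals_iff cmod_def complex_eq_iff power2_eq_1_iff)
  then have nz: "\<zeta> \<noteq> 0" by auto
  have "\<zeta> = cis (Im (Ln \<zeta>))"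
    using exp_Ln[OF nz] norm_\<zeta> exp_eq_polar[of "Ln \<zeta>"] norm_exp_eq_Re[of "Ln \<zeta>"] by simp
  then have "Complex (z $ 1) (z $ 2) = cis (\<omega> + Im (Ln \<zeta>))"
    using z by (metis cis_mult add.commute)
  then have eq: "cyl \<omega> (Im (Ln \<zeta>), z $ 3) = z"
    by (simp add: vec3_eq_iff complex_eq_iff)
  have bounds: "Im (Ln \<zeta>) \<in> {-pi<..<pi}"
    using \<zeta> nz mpi_less_Im_Ln[OF nz] Im_Ln_le_pi[OF nz] Im_Ln_eq_pi[OF nz]
    by (auto simp: less_le complex_nonpos_Reals_iff)
  have inj: "inj_on (cyl \<omega>) ({-pi<..<pi} \<times> UNIV)"
  proof (rule inj_onI)
    fix p q assume pq: "p \<in> {-pi<..<pi} \<times> UNIV" "q \<in> {-pi<..<pi} \<times> UNIV" "cyl \<omega> p = cyl \<omega> q"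
    then have *: "sin (\<omega> + fst p) = sin (\<omega> + fst q) \<and> cos (\<omega> + fst p) = cos (\<omega> + fst q)"
      and "snd p = snd q" by (auto simp: vec3_eq_iff)
    from * obtain n :: int where n: "\<omega> + fst p = \<omega> + fst q + 2 * pi * n"
      using sin_cos_eq_iff by blast
    then have "\<bar>2 * pi * n\<bar> < 2 * pi * 1" using pq by auto
    then have "\<bar>real_of_int n\<bar> < 1" by (simp add: abs_mult)
    then have "n = 0" by linarith
    then show "p = q" using n \<open>snd p = snd q\<close> by (simp add: prod_eq_iff)
  qed
  show "cyl_inv \<omega> z = (Im (Ln \<zeta>), z $ 3)"
    unfolding cyl_inv_def using bounds by (intro inv_into_f_eq[OF inj _ eq]) auto
qed

lemma continuous_on_cyl_inv:
  "continuous_on {z \<in> MI. PL z \<noteq> - vector [cos \<omega>, sin \<omega>, 0]} (cyl_inv \<omega>)"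
proof -
  let ?Z = "{z \<in> MI. PL z \<noteq> - vector [cos \<omega>, sin \<omega>, 0]}"
  have "continuous_on ?Z (\<lambda>z. (Im (Ln (Complex (z $ 1) (z $ 2) * cis (- \<omega>))), z $ 3))"
    using cyl_inv_eq(1) by (intro continuous_intros) auto
  then show ?thesis by (rule continuous_on_eq) (auto simp: cyl_inv_eq(2))
qed

text \<open>Stated for the explicit formula, which makes sense near the point in all of space and
  not only on the cylinder. At this point the rotated number is 1.\<close>

lemma differentiable_cyl_chart:
  "(\<lambda>z. (Im (Ln (Complex (z $ 1) (z $ 2) * cis (- \<omega>))), z $ 3))
    differentiable (at (vector [cos \<omega>, sin \<omega>, 0] :: real^3))"
proof -
  let ?e = "vector [cos \<omega>, sin \<omega>, 0] :: real^3"
  let ?f = "\<lambda>z :: real^3. Complex (z $ 1) (z $ 2) * cis (- \<omega>)"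
  have lin: "bounded_linear (\<lambda>z :: real^3. Complex (z $ 1) (z $ 2))"
    by (intro bounded_linearI' linearI) (auto simp: complex_eq_iff)
  have f: "(?f has_derivative ?f) (at ?e)"
    by (intro bounded_linear.has_derivative[OF bounded_linear_mult_left]
        bounded_linear.has_derivative[OF lin] has_derivative_ident)
  have "?f ?e = cis \<omega> * cis (- \<omega>)" by (simp add: cis.ctr)
  then have "?f ?e = 1" by (simp add: cis_mult)
  then have "(Ln has_field_derivative 1) (at (?f ?e))"
    using has_field_derivative_Ln[of "?f ?e"] by simp
  then have "(Ln has_derivative (*) 1) (at (?f ?e))" by (simp add: has_field_derivative_def)
  from has_derivative_compose[OF f this]
  have "((\<lambda>z. Ln (?f z)) has_derivative (\<lambda>z. 1 * ?f z)) (at ?e)" .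
  then have "((\<lambda>z. (Im (Ln (?f z)), z $ 3)) has_derivative (\<lambda>z. (Im (1 * ?f z), z $ 3))) (at ?e)"
    by (intro has_derivative_Pair bounded_linear.has_derivative[OF bounded_linear_Im]
        bounded_linear.has_derivative[OF bounded_linear_vec_nth] has_derivative_ident)
  then show ?thesis by (rule differentiableI)
qed

text \<open>Cramer's rule with the nonzero determinant \<open>d\<close>. The linear map
  \<open>c\<close> agrees with \<open>basis_coords\<close> on \<open>Lsp\<close> and supplies the
  bound there.\<close>

lemma basis_coords_Lsp:
  assumes v: "v \<in> Lsp" and w: "w \<in> Lsp"
    and ind: "\<And>a b. a *\<^sub>R v + b *\<^sub>R w = 0 \<Longrightarrow> a = 0 \<and> b = 0"
  shows "basis_coords v w (a *\<^sub>R v + b *\<^sub>R w) = (a, b)"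
    and "x \<in> Lsp \<Longrightarrow> x = fst (basis_coords v w x) *\<^sub>R v + snd (basis_coords v w x) *\<^sub>R w"
    and "\<exists>B. \<forall>x\<in>Lsp. norm (basis_coords v w x) \<le> B * norm x"
proof -
  have v3: "v $ 3 = 0" "w $ 3 = 0" using v w by (auto simp: Lsp_iff)
  define d where "d = v $ 1 * w $ 2 - v $ 2 * w $ 1"
  have d: "d \<noteq> 0"
  proof
    assume "d = 0"
    then have "(w $ 2) *\<^sub>R v + (- v $ 2) *\<^sub>R w = 0" "(w $ 1) *\<^sub>R v + (- v $ 1) *\<^sub>R w = 0"
      using v3 by (auto simp: d_def vec3_eq_iff algebra_simps)
    from ind[OF this(1)] ind[OF this(2)] have "v = 0" using v3 by (auto simp: vec3_eq_iff)
    then show False using ind[of 1 0] by simp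
  qed
  have uniq: "a = a' \<and> b = b'" if "a *\<^sub>R v + b *\<^sub>R w = a' *\<^sub>R v + b' *\<^sub>R w" for a b a' b'
    using ind[of "a - a'" "b - b'"] that by (simp add: algebra_simps)
  show coords: "basis_coords v w (a *\<^sub>R v + b *\<^sub>R w) = (a, b)" for a b
    unfolding basis_coords_def by (rule the_equality) (auto dest: uniq)
  define c where "c x = ((x $ 1 * w $ 2 - x $ 2 * w $ 1) / d, (v $ 1 * x $ 2 - v $ 2 * x $ 1) / d)"
    for x :: "real^3"
  have c: "fst (c x) *\<^sub>R v + snd (c x) *\<^sub>R w = x" if "x \<in> Lsp" for x
  proof -
    have "v $ 1 * ((x $ 1 * w $ 2 - x $ 2 * w $ 1) / d) + w $ 1 * ((v $ 1 * x $ 2 - v $ 2 * x $ 1) / d)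
        = x $ 1 * d / d"
      unfolding d_def by (simp add: algebra_simps flip: add_divide_distrib diff_divide_distrib)
    moreover have "v $ 2 * ((x $ 1 * w $ 2 - x $ 2 * w $ 1) / d) + w $ 2 * ((v $ 1 * x $ 2 - v $ 2 * x $ 1) / d)
        = x $ 2 * d / d"
      unfolding d_def by (simp add: algebra_simps flip: add_divide_distrib diff_divide_distrib)
    ultimately show ?thesis
      using d v3 that by (simp add: c_def vec3_eq_iff Lsp_iff mult.commute)
  qed
  have eq: "basis_coords v w x = c x" if "x \<in> Lsp" for x
    using coords[of "fst (c x)" "snd (c x)"] c[OF that] by simp
  show "x = fst (basis_coords v w x) *\<^sub>R v + snd (basis_coords v w x) *\<^sub>R w" if "x \<in> Lsp"
    using eq[OF that] c[OF that] by simp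
  have "linear c"
    by (intro linearI) (auto simp: c_def algebra_simps add_divide_distrib diff_divide_distrib)
  then have "bounded_linear c" by (simp add: linear_conv_bounded_linear)
  from bounded_linear.bounded[OF this] obtain B where "\<And>x. norm (c x) \<le> norm x * B" by blast
  then show "\<exists>B. \<forall>x\<in>Lsp. norm (basis_coords v w x) \<le> B * norm x"
    using eq by (intro exI[of _ B]) (auto simp: mult.commute)
qed

text \<open>A supremum over the reals can be used only once the quotients are known to be bounded,
  which \<open>B\<close> ensures. The quotient at 0 is 0 and gives nonnegativity.\<close>

lemma onorm_on_bound:
  assumes "0 \<in> S" "\<And>x. x \<in> S \<Longrightarrow> norm (f x) \<le> B * norm x" "x \<in> S"
  shows "0 \<le> onorm_on S f" "norm (f x) \<le> onorm_on S f * norm x"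
proof -
  \<comment> \<open>The maximum with 0 is taken because \<open>B\<close> may be negative and the
    quotient at 0 is 0.\<close>
  have "norm (f y) / norm y \<le> max B 0" if "y \<in> S" for y
  proof (cases "y = 0")
    case False
    have "B * norm y \<le> max B 0 * norm y" by (intro mult_right_mono) auto
    then show ?thesis using order_trans[OF assms(2)[OF that]] False by (simp add: pos_divide_le_eq)
  qed simp
  then have bdd: "bdd_above ((\<lambda>x. norm (f x) / norm x) ` S)" by (rule bdd_aboveI2)
  show "0 \<le> onorm_on S f"
    unfolding onorm_on_def using cSUP_upper[OF assms(1) bdd] by simp
  have "norm (f x) / norm x \<le> onorm_on S f"
    unfolding onorm_on_def using cSUP_upper[OF assms(3) bdd] .
  then show "norm (f x) \<le> onorm_on S f * norm x"
    using assms(2)[OF assms(3)] by (cases "x = 0") (auto simp: field_simps)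
qed

section \<open>Rescaled flows are near-linear\<close>

lemma differentiable_scaled_flow:
  assumes "C1_on UNIV (\<lambda>(t, x). F t x)"
  shows "(\<lambda>(t, x). scaled_flow \<epsilon> F t x) differentiable (at p)"
proof -
  have F: "(\<lambda>(t, x). F t x) differentiable (at q)" for q
    using assms unfolding C1_on_def differentiable_def by blast
  have "(\<lambda>p. (fst p, \<epsilon> *\<^sub>R snd p)) differentiable (at p)"
    by (intro differentiableI[of _ "\<lambda>p. (fst p, \<epsilon> *\<^sub>R snd p)"] bounded_linear_imp_has_derivative
        bounded_linear_Pair bounded_linear_fst bounded_linear_const_scaleR bounded_linear_snd)
  then have "(\<lambda>p. (1 / \<epsilon>) *\<^sub>R (case (fst p, \<epsilon> *\<^sub>R snd p) of (t, x) \<Rightarrow> F t x)) differentiable (at p)"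
    by (intro differentiable_scaleR differentiable_const differentiable_compose[OF F])
  then show ?thesis by (simp add: scaled_flow_def case_prod_beta')
qed

lemma is_flow_scaled_flow: "is_flow F \<Longrightarrow> \<epsilon> \<noteq> 0 \<Longrightarrow> is_flow (scaled_flow \<epsilon> F)"
  by (auto simp: is_flow_def scaled_flow_def)

lemma convex_B1: "convex B1"
proof -
  have "linear PL" using bounded_linear_PL by (simp add: linear_conv_bounded_linear)
  moreover have "linear PU" by (intro linearI) (auto simp: vec3_eq_iff)
  moreover have "B1 = PL -` cball 0 1 \<inter> PU -` cball 0 1" by (auto simp: B1_def)
  ultimately show ?thesis by (metis convex_Int convex_linear_vimage convex_cball)
qed

text \<open>The mean value inequality for \<open>G t\<close> minus \<open>A\<close> on a convex
  set.\<close>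

lemma flow_close_to_linear:
  assumes diff: "\<And>p. (\<lambda>(t, x). G t x) differentiable (at p)"
    and A: "bounded_linear A"
    and bound: "\<And>x. x \<in> S \<Longrightarrow> onorm (\<lambda>v. D2 G t x v - A v) \<le> \<eta>"
    and S: "convex S" "x \<in> S" "y \<in> S"
  shows "norm (G t x - G t y - A (x - y)) \<le> \<eta> * norm (x - y)"
proof -
  have "norm ((G t x - A x) - (G t y - A y)) \<le> \<eta> * norm (x - y)"
  proof (rule differentiable_bound[OF S(1) _ bound S(2,3)])
    fix x
    have "(\<lambda>x. case (t, x) of (t, x) \<Rightarrow> G t x) differentiable (at x)"
      by (rule differentiable_compose[OF diff])
        (rule differentiableI[OF has_derivative_Pair[OF has_derivative_const has_derivative_ident]])
    then have "(G t has_derivative D2 G t x) (at x)"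
      by (simp add: D2_def frechet_derivative_works)
    then show "((\<lambda>x. G t x - A x) has_derivative (\<lambda>v. D2 G t x v - A v)) (at x within S)"
      by (intro has_derivative_diff bounded_linear_imp_has_derivative[OF A])
        (rule has_derivative_at_withinI)
  qed
  then show ?thesis by (simp add: linear_diff[OF bounded_linear.linear[OF A]] algebra_simps)
qed

text \<open>Compare \<open>x\<close> with its projections. By invariance the orbit of
  \<open>PL x\<close> stays in \<open>Lsp\<close> and that of \<open>PU x\<close> in
  \<open>Usp\<close> during unit time, so the mean value inequality yields errors proportional to
  \<open>PU x\<close> and to \<open>PL x\<close> separately.\<close>

lemma near_linear_flow_scaled_flow:
  assumes setting: "basic_setting \<sigma> \<mu> u F h tU tL"
    and rescaling: "rescaling_bounds u F epsfun epsB"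
    and \<epsilon>: "0 < \<epsilon>" "\<epsilon> < epsfun \<eta>" "\<epsilon> < epsB"
    and \<eta>: "0 < \<eta>" "\<eta> < exp \<sigma> / 2" "1 + \<eta> * exp (-\<sigma>) < exp (-\<sigma> / 2)" "mC \<eta> \<sigma> < u"
  shows "near_linear_flow (scaled_flow \<epsilon> F) \<sigma> u \<eta> (mC \<eta> \<sigma>)"
proof -
  let ?G = "scaled_flow \<epsilon> F"
  have F: "is_flow F" "C1_on UNIV (\<lambda>(t, x). F t x)" and \<sigma>: "\<sigma> < 0" and u: "0 < u"
    and T: "\<And>t x. D2 F t 0 x =
      vector [exp (\<sigma> * t) * (cos (\<mu> * t) * x$1 + sin (\<mu> * t) * x$2),
              exp (\<sigma> * t) * (- sin (\<mu> * t) * x$1 + cos (\<mu> * t) * x$2),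
              exp (u * t) * x$3]"
    using setting by (auto simp: basic_setting_def)
  have G: "is_flow ?G" using F(1) \<epsilon>(1) by (intro is_flow_scaled_flow) auto
  note diff = differentiable_scaled_flow[OF F(2), of \<epsilon>]
  have A: "bounded_linear (D2 F t 0)" for t
    by (intro bounded_linearI' linearI) (auto simp: T vec3_eq_iff algebra_simps)
  have R: "\<And>x t. t \<in> {0..1} \<Longrightarrow> x \<in> B1 \<Longrightarrow> onorm (\<lambda>v. D2 ?G t x v - D2 F t 0 v) \<le> \<eta>"
    and B: "\<And>t x. t \<in> {0..1} \<Longrightarrow> x \<in> B1 \<Longrightarrow> ?G t x \<in> cball 0 (rB u F)"
    and inv: "invariant_in ?G Lsp (cball 0 (rB u F))" "invariant_in ?G Usp (cball 0 (rB u F))"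
    using rescaling \<epsilon> \<eta>(1) unfolding rescaling_bounds_def by (blast intro: less_imp_le)+
  have inv_step: "?G t x \<in> M"
    if M: "invariant_in ?G M (cball 0 (rB u F))" "x \<in> M" and tx: "t \<in> {0..1}" "x \<in> B1" for M t x
  proof -
    have "?G 0 x = x" using G by (simp add: is_flow_def)
    then have "x \<in> M \<inter> cball 0 (rB u F)" using M(2) B[of 0 x] tx by simp
    moreover have "is_interval {0..1::real}" by (rule is_interval_cc)
    ultimately show ?thesis
      using M(1) B tx unfolding invariant_in_def by (metis atLeastAtMost_iff order_refl zero_le_one)
  qed
  have near: "norm (?G t x - ?G t y - D2 F t 0 (x - y)) \<le> \<eta> * norm (x - y)"
    if "t \<in> {0..1}" "x \<in> B1" "y \<in> B1" for t x y
    using that by (intro flow_close_to_linear[OF diff A R convex_B1]) auto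
  show ?thesis
  proof
    show "is_flow ?G" by (rule G)
    show "continuous_on UNIV (\<lambda>(t, x). ?G t x)"
      using diff by (intro differentiable_imp_continuous_on) (auto simp: differentiable_on_def)
    show "\<sigma> < 0" "0 < u" "0 < \<eta>" "1 + \<eta> * exp (-\<sigma>) < exp (-\<sigma> / 2)" "mC \<eta> \<sigma> < u" by fact+
    show "\<eta> < exp \<sigma>" using \<eta>(2) exp_gt_zero[of \<sigma>] by linarith
    have small: "0 < \<eta> * exp (-\<sigma>)" "\<eta> * exp (-\<sigma>) < 1"
      using \<eta>(1) \<open>\<eta> < exp \<sigma>\<close> by (auto simp: exp_minus field_simps)
    \<comment> \<open>The logarithmic entries of the maximum \<open>mC\<close> are the two
      conditions on \<open>m\<close> in the locale.\<close>
    have "ln (1 + \<eta> * exp (-\<sigma>)) \<le> mC \<eta> \<sigma>" "ln (1 / (1 - \<eta> * exp (-\<sigma>))) \<le> mC \<eta> \<sigma>"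
      by (auto simp: mC_def)
    then have ln: "ln (1 + \<eta> * exp (-\<sigma>)) \<le> mC \<eta> \<sigma>" "- mC \<eta> \<sigma> \<le> ln (1 - \<eta> * exp (-\<sigma>))"
      using small by (auto simp: ln_div)
    have pos: "0 < 1 + \<eta> * exp (-\<sigma>)" "0 < 1 - \<eta> * exp (-\<sigma>)" using small by auto
    show "1 + \<eta> * exp (-\<sigma>) \<le> exp (mC \<eta> \<sigma>)" using ln(1) by (metis exp_le_cancel_iff exp_ln pos(1))
    show "exp (- mC \<eta> \<sigma>) \<le> 1 - \<eta> * exp (-\<sigma>)" using ln(2) by (metis exp_le_cancel_iff exp_ln pos(2))
    fix t :: real and x assume t: "t \<in> {0..1}" and x: "x \<in> B1"
    have PLx: "PL x \<in> B1" "PL x \<in> Lsp" and PUx: "PU x \<in> B1" "PU x \<in> Usp"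
      using x by (auto simp: B1_def norm_PL norm_PU Lsp_iff Usp_iff)
    have "?G t (PL x) $ 3 = 0" using inv_step[OF inv(1) PLx(2) t PLx(1)] by (simp add: Lsp_iff)
    then have "\<bar>?G t x $ 3 - exp (u * t) * x $ 3\<bar> = \<bar>(?G t x - ?G t (PL x) - D2 F t 0 (x - PL x)) $ 3\<bar>"
      by (simp add: T)
    also have "\<dots> \<le> norm (?G t x - ?G t (PL x) - D2 F t 0 (x - PL x))"
      by (rule component_le_norm_cart)
    also have "\<dots> \<le> \<eta> * norm (x - PL x)" by (rule near[OF t x PLx(1)])
    also have "x - PL x = PU x" by (simp add: vec3_eq_iff)
    finally show "\<bar>?G t x $ 3 - exp (u * t) * x $ 3\<bar> \<le> \<eta> * \<bar>x $ 3\<bar>" by (simp add: norm_PU)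
    let ?e = "?G t x - ?G t (PU x) - D2 F t 0 (x - PU x)"
    have "PL (?G t (PU x)) = 0"
      using inv_step[OF inv(2) PUx(2) t PUx(1)] by (simp add: Usp_iff vec3_eq_iff)
    moreover have "x - PU x = PL x" by (simp add: vec3_eq_iff)
    ultimately have e: "PL (?G t x) = PL (D2 F t 0 (PL x)) + PL ?e"
      by (simp add: linear_diff[OF bounded_linear.linear[OF bounded_linear_PL]])
    \<comment> \<open>The planar part of the linearization is a rotation scaled by
      \<open>exp (\<sigma> * t)\<close>.\<close>
    have rot_id: "(q * (c * a + s * b))\<^sup>2 + (q * (- s * a + c * b))\<^sup>2 = q\<^sup>2 * ((s\<^sup>2 + c\<^sup>2) * (a\<^sup>2 + b\<^sup>2))"
      for q c s a b :: real
      by (simp add: power2_eq_square algebra_simps)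
    have rot: "norm (PL (D2 F t 0 (PL x))) = exp (\<sigma> * t) * norm (PL x)"
      using rot_id[of "exp (\<sigma> * t)" "cos (\<mu> * t)" "x $ 1" "sin (\<mu> * t)" "x $ 2"]
      by (simp add: norm_PL T real_sqrt_mult)
    have "norm (PL ?e) \<le> norm ?e" by (rule norm_PL_le)
    also have "\<dots> \<le> \<eta> * norm (PL x)" using near[OF t x PUx(1)] \<open>x - PU x = PL x\<close> by simp
    finally show "\<bar>norm (PL (?G t x)) - exp (\<sigma> * t) * norm (PL x)\<bar> \<le> \<eta> * norm (PL x)"
      using norm_triangle_ineq3[of "PL (?G t x)" "PL (D2 F t 0 (PL x))"] e rot by simp
  qed
qed

lemma ME_iff: "y \<in> ME r \<longleftrightarrow> y $ 3 = 1 \<and> norm (y - e3) < r"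
proof -
  have "(\<exists>x\<in>Lsp. y = e3 + x) \<longleftrightarrow> y $ 3 = 1"
    by (auto simp: Lsp_iff e3_def axis_def intro: bexI[of _ "y - axis 3 1"])
  then show ?thesis by (simp add: ME_def)
qed

text \<open>Amounts to differentiability at \<open>e3\<close> along the plane, with the explicit
  chart formula in place of \<open>cyl_inv\<close>. It is what makes \<open>v\<close> and
  \<open>w\<close> linearly independent.\<close>

lemma tangent_map_linear:
  assumes G: "\<And>p. (\<lambda>(t, x). G t x) differentiable (at p)"
    and tt: "C1_on (ME r) tt" and r: "0 < r"
    and E: "E = (\<lambda>y. G (tt y) y)"
    and E_ME: "\<And>y. y \<in> ME r \<Longrightarrow> E y \<in> MI \<and> PL (E y) \<noteq> - vector [cos \<omega>, sin \<omega>, 0]"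
    and E_e3: "vector [cos \<omega>, sin \<omega>, 0] = E e3"
  shows "linear (tangent_map (cyl_inv \<omega> \<circ> E))"
proof -
  let ?a = "\<lambda>x. e3 + PL x"
  let ?B = "ball (0 :: real^3) r"
  let ?H = "\<lambda>z :: real^3. (Im (Ln (Complex (z $ 1) (z $ 2) * cis (- \<omega>))), z $ 3)"
  have a: "(?a has_derivative PL) (at x within S)" for x S
    using has_derivative_add[OF has_derivative_const bounded_linear_imp_has_derivative[OF bounded_linear_PL]]
    by simp
  have a_ME: "?a x \<in> ME r" if "x \<in> ?B" for x
    using that norm_PL_le[of x] by (simp add: ME_iff e3_def axis_def)
  have a0: "?a 0 = e3" by (simp add: vec3_eq_iff)
  obtain t' where "(tt has_derivative t') (at (?a 0) within ME r)"
    using tt a_ME[of 0] r by (auto simp: C1_on_def)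
  \<comment> \<open>\<open>tt\<close> is differentiable only within the plane, but the map through
    \<open>PL\<close> sends a full ball into that plane, so the composition is differentiable in the
    ordinary sense.\<close>
  then have "(tt has_derivative t') (at (?a 0) within ?a ` ?B)"
    by (rule has_derivative_subset) (use a_ME in auto)
  from has_derivative_in_compose[OF a this]
  have "((\<lambda>x. tt (?a x)) has_derivative (\<lambda>x. t' (PL x))) (at 0 within ?B)" .
  then have "((\<lambda>x. tt (?a x)) has_derivative (\<lambda>x. t' (PL x))) (at 0)"
    using r by (simp add: at_within_open[of _ ?B])
  then have "(\<lambda>x. (tt (?a x), ?a x)) differentiable (at 0)"
    by (rule differentiableI[OF has_derivative_Pair[OF _ a]])
  from differentiable_compose[OF G this]
  have "(\<lambda>x. E (?a x)) differentiable (at 0)" by (simp add: E)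
  moreover have "?H differentiable (at (E (?a 0)))"
    unfolding a0 E_e3[symmetric] by (rule differentiable_cyl_chart)
  ultimately have "(\<lambda>x. ?H (E (?a x))) differentiable (at 0)"
    by (rule differentiable_compose[rotated])
  then obtain D where D: "((\<lambda>x. ?H (E (?a x))) has_derivative D) (at 0)"
    by (auto simp: differentiable_def)
  have "((\<lambda>x. (cyl_inv \<omega> \<circ> E) (?a x)) has_derivative D) (at 0)"
    by (rule has_derivative_transform_within_open[OF D, of ?B])
      (use r E_ME[OF a_ME] in \<open>auto simp: cyl_inv_eq(2)\<close>)
  then have "(\<lambda>x. (cyl_inv \<omega> \<circ> E) (?a x)) differentiable (at 0)" by (rule differentiableI)
  then show ?thesis
    unfolding tangent_map_def frechet_derivative_works using has_derivative_linear by blast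
qed

subsection \<open>The return map\<close>

theorem proposition8p1:
  fixes \<sigma> \<mu> u tU tL epsB \<eta>t \<eta> \<delta>star \<delta>j \<omega> \<beta> \<alpha> c k \<delta>\<beta> \<Delta>1 \<Delta>2 m1 m2 \<psi>j :: real
    and F G :: "real \<Rightarrow> real^3 \<Rightarrow> real^3"
    and h :: "real \<Rightarrow> real^3"
    and epsfun tE :: "real \<Rightarrow> real"
    and tI eps r :: "nat \<Rightarrow> real"
    and tt :: "nat \<Rightarrow> real^3 \<Rightarrow> real"
    and j :: nat
    and E :: "real^3 \<Rightarrow> real^3"
    and v w :: "real^3"
    and \<kappa> P :: "real^3 \<Rightarrow> real \<times> real"
    and Q :: "real \<times> real \<Rightarrow> real \<times> real"
    and \<Phi> :: "real \<times> real \<Rightarrow> real"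
    and M0 M1 :: "(real \<times> real) set"
  assumes setting: "basic_setting \<sigma> \<mu> u F h tU tL"
    and rescaling: "rescaling_bounds u F epsfun epsB"
    and exterior: "exterior_data F h tU tL tE tI eps r tt"
    and \<eta>t: "0 < \<eta>t" "\<eta>t < min \<mu> (-\<sigma> / 2)"
    and c: "c = ((u + \<eta>t) * (\<mu> + \<eta>t)) / ((u - \<eta>t) * (\<mu> - \<eta>t))"
    and k: "k = exp (- 6 * pi * ((u + \<eta>t) / (\<mu> - \<eta>t)))"
    and \<eta>t_c: "c * ((-\<sigma> + \<eta>t) / (u - \<eta>t)) < 1"
    and C: "conditions_C \<sigma> u epsfun epsB eps r \<eta>t \<eta> j \<delta>star \<delta>j"
    and G: "G = scaled_flow (eps j) F"
    and E: "E = (\<lambda>y. G (tt j y) y)"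
    and \<omega>: "-pi \<le> \<omega>" "\<omega> < pi" "vector [cos \<omega>, sin \<omega>, 0] = E e3"
    and Q: "Q = cyl_inv \<omega> \<circ> E \<circ> inner_map G \<circ> cyl \<omega>"
    and v: "v \<in> Lsp" "tangent_map (cyl_inv \<omega> \<circ> E) v = (1, 0)"
    and w: "w \<in> Lsp" "tangent_map (cyl_inv \<omega> \<circ> E) w = (0, 1)"
    and \<kappa>: "\<kappa> = basis_coords v w"
    and P: "P = \<kappa> \<circ> PL"
    and \<Phi>: "\<Phi> = angle_fun G \<omega>"
    and \<beta>: "0 < \<beta>" "\<beta> \<le> 1 / 2"
    and \<alpha>: "0 < \<alpha>" "\<alpha> < pi" "near_identity_square (ME (r j)) P (cyl_inv \<omega> \<circ> E) \<beta> \<alpha>"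
    and \<alpha>_less: "\<alpha> < \<delta>j"
    and \<delta>\<beta>: "\<delta>\<beta> = (2 / (3 * (onorm_on Lsp \<kappa> + 1)) * \<alpha>) powr (3 * u / (-\<sigma>))"
    and \<Delta>2: "0 < \<Delta>2" "\<Delta>2 < \<delta>\<beta>"
      "2 * sqrt 2 * \<Delta>2 <
        1 / onorm (inv_into Lsp \<kappa>) * k powr ((-\<sigma> + \<eta>t) / (u - \<eta>t))
          * \<Delta>2 powr (c * ((-\<sigma> + \<eta>t) / (u - \<eta>t)))"
    and \<Delta>1: "\<Delta>1 = k * \<Delta>2 powr c"
    and m1: "m1 = (SUP \<gamma>\<in>{-\<alpha>..\<alpha>}. \<Phi> (\<gamma>, \<Delta>1))"
    and m2: "m2 = (INF \<psi>\<in>{-\<alpha>..\<alpha>}. \<Phi> (\<psi>, \<Delta>2))"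
    and \<psi>j: "m1 + pi \<le> \<psi>j" "\<psi>j \<le> m2 - pi"
      "vector [cos \<psi>j, sin \<psi>j, 0] = (1 / norm w) *\<^sub>R w"
    and M0: "M0 = {(\<psi>, \<delta>). (\<psi>, \<delta>) \<in> {-\<alpha>..\<alpha>} \<times> {\<Delta>1..\<Delta>2} \<and>
      \<psi>j - pi < \<Phi> (\<psi>, \<delta>) \<and> \<Phi> (\<psi>, \<delta>) < \<psi>j}"
    and M1: "M1 = {(\<psi>, \<delta>). (\<psi>, \<delta>) \<in> {-\<alpha>..\<alpha>} \<times> {\<Delta>1..\<Delta>2} \<and>
      \<psi>j < \<Phi> (\<psi>, \<delta>) \<and> \<Phi> (\<psi>, \<delta>) < \<psi>j + pi}"
  shows "\<forall>s :: nat \<Rightarrow> nat. (\<forall>n. s n \<in> {0, 1}) \<longrightarrow>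
    (\<exists>x :: nat \<Rightarrow> real \<times> real.
      (\<forall>n. x (Suc n) = Q (x n)) \<and>
      (\<forall>n. x n \<in> {-\<alpha>..\<alpha>} \<times> {\<Delta>1..\<Delta>2}) \<and>
      (\<forall>n. x n \<in> (if s n = 0 then M0 else M1) \<and>
        \<Delta>1 \<le> snd (Q (x n)) \<and> snd (Q (x n)) \<le> \<Delta>2))"
proof -

  \<comment> \<open>Local flow, exterior map and planar coordinates\<close>
  have \<sigma>: "\<sigma> < 0" "0 < \<mu>" "0 < u" "0 < \<sigma> + u" and C1_F: "C1_on UNIV (\<lambda>(t, x). F t x)"
    and flow_h: "\<And>t s. h (t + s) = F t (h s)"
    using setting by (auto simp: basic_setting_def)
  define m where "m = mC \<eta> \<sigma>"
  have j: "1 \<le> j" "eps j < epsfun \<eta>" "eps j < epsB" and m_less: "m < \<eta>t"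
    and \<delta>j: "0 < \<delta>j" "\<delta>j < 1" "1 / (u + ln 2) * ln (1 / \<delta>j) - 1 > m / (\<eta>t - m)"
    and \<eta>: "0 < \<eta>" "\<eta> < exp \<sigma> / 2" "1 + \<eta> * exp (-\<sigma>) < exp (-\<sigma> / 2)"
    using C by (auto simp: conditions_C_def m_def)
  have ext: "0 < eps j" "eps j < norm (h tU)" "0 < r j" "C1_on (ME (r j)) (tt j)"
    "tt j e3 = tI j - tE (eps j)"
    "\<And>y. y \<in> ME (r j) \<Longrightarrow> E y \<in> MI \<and> PL (E y) \<noteq> - scaled_curve (eps j) h (tI j)"
    "\<And>y. y \<in> ME (r j) \<Longrightarrow> vector_derivative (\<lambda>t. G t y) (at 0) \<notin> Lsp"
    "scaled_curve (eps j) h (tE (eps j)) = e3"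
    using exterior j(1) by (auto simp: exterior_data_def E G)
  have "\<eta>t < u" using \<eta>t \<sigma> by linarith
  interpret near_linear_flow G \<sigma> u \<eta> m
    unfolding G m_def using \<eta>t \<sigma> m_less \<open>\<eta>t < u\<close>
    by (intro near_linear_flow_scaled_flow[OF setting rescaling ext(1) j(2,3) \<eta>]) (simp add: m_def)
  have diff_G: "(\<lambda>(t, x). G t x) differentiable (at p)" for p
    unfolding G by (rule differentiable_scaled_flow[OF C1_F])
  have diff_t: "(\<lambda>t. G t y) differentiable (at t)" for t y
  proof -
    have "(\<lambda>t. case (t, y) of (t, x) \<Rightarrow> G t x) differentiable (at t)"
      by (rule differentiable_compose[OF diff_G])
        (rule differentiableI[OF has_derivative_Pair[OF has_derivative_ident has_derivative_const]])
    then show ?thesis by simp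
  qed
  \<comment> \<open>The homoclinic flowline passes through \<open>e3\<close> and is followed up to
    time \<open>tI j\<close>; hence \<open>E e3\<close> lies on it and the chart is centred
    there.\<close>
  have "eps j *\<^sub>R e3 = h (tE (eps j))"
    using ext(1) by (simp add: scaled_curve_def flip: ext(8))
  then have "E e3 = scaled_curve (eps j) h (tI j)"
    using flow_h[of "tt j e3" "tE (eps j)"]
    by (simp add: E G scaled_flow_def scaled_curve_def ext(5))
  then have E_ME: "E y \<in> MI \<and> PL (E y) \<noteq> - vector [cos \<omega>, sin \<omega>, 0]" if "y \<in> ME (r j)" for y
    using ext(6)[OF that] \<omega>(3) by simp
  let ?f = "cyl_inv \<omega> \<circ> E"
  have "linear (tangent_map ?f)"
    by (rule tangent_map_linear[OF diff_G ext(4,3) E E_ME \<omega>(3)])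
  \<comment> \<open>A linear map sending \<open>v\<close>, \<open>w\<close> to the standard basis
    forces their independence.\<close>
  then have ind: "a = 0 \<and> b = 0" if "a *\<^sub>R v + b *\<^sub>R w = 0" for a b
    using arg_cong[OF that, of "tangent_map ?f"] v(2) w(2)
    by (simp add: linear_add linear_scale linear_0 zero_prod_def)
  note coords = basis_coords_Lsp[OF v(1) w(1) ind, folded \<kappa>]
  define K where "K = onorm_on Lsp \<kappa>"
  have zero_Lsp: "0 \<in> Lsp" by (simp add: Lsp_iff)
  obtain B where "\<And>x. x \<in> Lsp \<Longrightarrow> norm (\<kappa> x) \<le> B * norm x" using coords(3) by blast
  note K = onorm_on_bound[OF zero_Lsp this, folded K_def]
  have K_pos: "0 \<le> K" by (rule K(1)[OF _ zero_Lsp])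
  have inj_\<kappa>: "inj_on \<kappa> Lsp" by (rule inj_onI) (metis coords(2))
  have lin_Lsp: "a *\<^sub>R v + b *\<^sub>R w \<in> Lsp" for a b
    using v(1) w(1) by (simp add: Lsp_iff)
  have inv_\<kappa>: "inv_into Lsp \<kappa> q = fst q *\<^sub>R v + snd q *\<^sub>R w" for q
    by (rule inv_into_f_eq[OF inj_\<kappa> lin_Lsp]) (simp add: coords(1))
  \<comment> \<open>\<open>K\<close> bounds \<kappa> from above on \<open>Lsp\<close>, while
    \<open>W\<close> bounds its inverse and thereby \<kappa> from below.\<close>
  define W where "W = onorm (inv_into Lsp \<kappa>)"
  have bl: "bounded_linear (inv_into Lsp \<kappa>)"
    by (intro bounded_linearI' linearI) (auto simp: inv_\<kappa> algebra_simps)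
  have W_nn: "0 \<le> W" unfolding W_def by (rule onorm_pos_le[OF bl])
  have W: "norm x \<le> W * norm (\<kappa> x)" if "x \<in> Lsp" for x
    using onorm[OF bl, of "\<kappa> x"] inv_into_f_f[OF inj_\<kappa> that] by (simp add: W_def)

  \<comment> \<open>Consequences of the choice of constants\<close>
  define s where "s = - \<sigma>"
  define e where "e = (s + \<eta>t) / (u - \<eta>t)"
  define b where "b = 2 / (3 * (K + 1)) * \<alpha>"
  \<comment> \<open>\<open>e\<close> is the exponent of the lower bound in
    \<open>radius_bounds\<close>, and \<open>b\<close> is the base of the power defining
    \<open>\<delta>\<beta>\<close>.\<close>
  have s: "0 < s" "s < u" "\<eta>t < s / 2" using \<sigma> \<eta>t by (auto simp: s_def)
  have b: "0 < b" "b \<le> 2 / 3 * \<alpha>" "(K + 1) * b = 2 / 3 * \<alpha>"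
    using \<alpha>(1) K_pos by (auto simp: b_def field_simps)
  have b1: "b < 1" using b(2) \<alpha>(1) \<alpha>_less \<delta>j by linarith
  have powr_le_b: "b powr q \<le> b" if "1 \<le> q" for q
    using powr_mono'[OF that less_imp_le[OF b(1)] less_imp_le[OF b1]] b(1) by simp
  have \<delta>\<beta>_b: "\<delta>\<beta> = b powr (3 * u / s)" by (simp add: \<delta>\<beta> b_def K_def s_def)
  have "1 \<le> 3 * u / s" using s by (simp add: field_simps)
  then have "\<delta>\<beta> \<le> b" unfolding \<delta>\<beta>_b by (rule powr_le_b)
  then have \<Delta>2_lt: "\<Delta>2 < \<delta>j" "\<Delta>2 < 1" using \<Delta>2(2) b(2) \<alpha>(1) \<alpha>_less \<delta>j by linarith+
  have "(u - \<eta>t) * (\<mu> - \<eta>t) \<le> (u + \<eta>t) * (\<mu> + \<eta>t)"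
    using \<eta>t \<sigma> \<open>\<eta>t < u\<close> by (intro mult_mono) auto
  then have "1 \<le> c" using \<eta>t \<open>\<eta>t < u\<close> by (simp add: c)
  then have "\<Delta>2 powr c \<le> \<Delta>2"
    using powr_mono'[of 1 c \<Delta>2] \<Delta>2(1) \<Delta>2_lt(2) by simp
  moreover have "0 < k" "k < 1"
    using \<sigma> \<eta>t by (auto simp: k)
  ultimately have \<Delta>1_less: "\<Delta>1 < \<Delta>2" and \<Delta>1_pos: "0 < \<Delta>1"
    using \<Delta>2(1) by (auto simp: \<Delta>1 intro: le_less_trans[OF mult_left_mono[of _ \<Delta>2 k]])
  \<comment> \<open>Turns the condition on \<open>\<Delta>2\<close> into one on the least possible
    exit radius, that of the bottom height \<open>\<Delta>1\<close>.\<close>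
  have \<Delta>1_e: "\<Delta>1 powr e = k powr e * \<Delta>2 powr (c * e)"
    using \<open>0 < k\<close> by (simp add: \<Delta>1 powr_mult powr_powr)

  \<comment> \<open>Estimates on the rectangle\<close>
  define R where "R = {-\<alpha>..\<alpha>} \<times> {\<Delta>1..\<Delta>2}"
  define y where "y p = inner_map G (cyl \<omega> p)" for p
  define q where "q p = \<kappa> (PL (y p))" for p
  define \<rho> where "\<rho> p = norm (PL (y p))" for p
  have snd_R: "0 < snd p" "snd p < 1" "snd p < \<delta>j" "\<Delta>1 \<le> snd p" "snd p \<le> \<Delta>2" if "p \<in> R" for p
    using that \<Delta>1_pos \<Delta>2_lt by (auto simp: R_def)
  have cyl_B1: "cyl \<omega> p \<in> B1" if "p \<in> R" for p
    using snd_R[OF that] by (intro MI_imp_B1 cyl_mem_MI) auto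
  have ex: "0 < exit_time G (cyl \<omega> p)" "G (exit_time G (cyl \<omega> p)) (cyl \<omega> p) $ 3 = 1"
    "\<And>s. s \<in> {0..exit_time G (cyl \<omega> p)} \<Longrightarrow> G s (cyl \<omega> p) $ 3 \<le> 1" if "p \<in> R" for p
    using exit_time[OF cyl_B1[OF that]] snd_R[OF that] by auto
  have PL_Lsp: "PL x \<in> Lsp" for x by (simp add: Lsp_iff)
  have \<rho>_bounds: "\<Delta>1 powr e \<le> \<rho> p" "\<rho> p \<le> b" if p: "p \<in> R" for p
  proof -
    have rb: "snd p powr e \<le> \<rho> p" "\<rho> p \<le> snd p powr ((s - \<eta>t) / (u + \<eta>t))"
      using radius_bounds[OF cyl_mem_MI, of \<omega> p \<delta>j \<eta>t] snd_R[OF p] \<delta>j m_less \<open>\<eta>t < u\<close> s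
      by (auto simp: \<rho>_def y_def e_def s_def)
    have "0 \<le> e" using \<open>\<eta>t < u\<close> \<eta>t s by (simp add: e_def)
    then have "\<Delta>1 powr e \<le> snd p powr e" using snd_R[OF p] \<Delta>1_pos by (intro powr_mono2) auto
    then show "\<Delta>1 powr e \<le> \<rho> p" using rb(1) by simp
    have e1: "0 \<le> (s - \<eta>t) / (u + \<eta>t)" using s \<eta>t \<sigma> by simp
    have "snd p powr ((s - \<eta>t) / (u + \<eta>t)) \<le> \<delta>\<beta> powr ((s - \<eta>t) / (u + \<eta>t))"
      using snd_R[OF p] \<Delta>2(2) e1 by (intro powr_mono2) auto
    also have "\<dots> = b powr (3 * u / s * ((s - \<eta>t) / (u + \<eta>t)))" by (simp add: \<delta>\<beta>_b powr_powr)
    \<comment> \<open>The exponent \<open>3 * u / s\<close> in \<open>\<delta>\<beta>\<close> was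
      chosen for this: \<open>u + \<eta>t\<close> is at most \<open>3 / 2 * u\<close> and
      \<open>s - \<eta>t\<close> is at least \<open>s / 2\<close>, so the product of exponents is at
      least 1.\<close>
    also have "\<dots> \<le> b"
    proof (rule powr_le_b)
      have "s * (u + \<eta>t) \<le> s * (3 / 2 * u)" using s by (intro mult_left_mono) auto
      also have "\<dots> = 3 * u * (s / 2)" by simp
      also have "\<dots> \<le> 3 * u * (s - \<eta>t)" using s by (intro mult_left_mono) auto
      finally show "1 \<le> 3 * u / s * ((s - \<eta>t) / (u + \<eta>t))" using s \<eta>t \<sigma> by simp
    qed
    finally show "\<rho> p \<le> b" using rb(2) by simp
  qed
  have \<rho>_pos: "0 < \<rho> p" if "p \<in> R" for p
    using \<rho>_bounds(1)[OF that] \<Delta>1_pos by (metis powr_gt_zero less_le_trans less_irrefl)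
  \<comment> \<open>The factor 2/3 leaves room for the relative error 1/2 of \<open>Q\<close>, since
    3/2 times 2/3 is 1.\<close>
  have q_upper: "norm (q p) \<le> 2 / 3 * \<alpha>" if "p \<in> R" for p
  proof -
    have "norm (q p) \<le> K * \<rho> p" unfolding q_def \<rho>_def by (rule K(2)[OF _ PL_Lsp])
    also have "\<dots> \<le> (K + 1) * b"
      using \<rho>_bounds(2)[OF that] \<rho>_pos[OF that] K_pos by (intro mult_mono) auto
    finally show ?thesis using b(3) by simp
  qed
  have q_lower: "2 * sqrt 2 * \<Delta>2 < norm (q p)" if "p \<in> R" for p
  proof -
    have "\<rho> p \<le> W * norm (q p)" unfolding q_def \<rho>_def by (rule W[OF PL_Lsp])
    moreover from this have "0 < W" using \<rho>_pos[OF that] W_nn by (cases "W = 0") auto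
    ultimately have "1 / W * \<rho> p \<le> norm (q p)" by (simp add: field_simps)
    moreover have "1 / W * \<Delta>1 powr e \<le> 1 / W * \<rho> p"
      using \<rho>_bounds(1)[OF that] \<open>0 < W\<close> by (intro mult_left_mono) auto
    ultimately show ?thesis
      using \<Delta>2(3) \<Delta>1_e by (simp add: W_def e_def s_def mult.assoc)
  qed
  have y3: "y p $ 3 = 1" if "p \<in> R" for p using ex(2)[OF that] by (simp add: y_def inner_map_def)
  have fst_le: "\<bar>fst z\<bar> \<le> norm z" and snd_le: "\<bar>snd z\<bar> \<le> norm z" for z :: "real \<times> real"
    by (cases z; simp add: norm_Pair; fail)+
  \<comment> \<open>\<open>q p\<close> lies in the square, so it is \<open>P\<close> of some point
    of \<open>ME (r j)\<close>. Since \<kappa> is injective on \<open>Lsp\<close> and both points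
    have height 1, that point is \<open>y p\<close> itself.\<close>
  have y_ME: "y p \<in> ME (r j)" and Q_q: "norm (Q p - q p) \<le> \<beta> * norm (q p)" if p: "p \<in> R" for p
  proof -
    have "\<bar>fst (q p)\<bar> \<le> \<alpha>" "\<bar>snd (q p)\<bar> \<le> \<alpha>"
      using fst_le[of "q p"] snd_le[of "q p"] q_upper[OF p] \<alpha>(1) by linarith+
    then have "q p \<in> {-\<alpha>..\<alpha>} \<times> {-\<alpha>..\<alpha>}" by (cases "q p") auto
    then have mem: "q p \<in> P ` ME (r j)"
      and near: "norm ((?f \<circ> inv_into (ME (r j)) P) (q p) - q p) \<le> \<beta> * norm (q p)"
      using \<alpha>(3) unfolding near_identity_square_def by auto
    define y' where "y' = inv_into (ME (r j)) P (q p)"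
    have y': "y' \<in> ME (r j)" "P y' = q p"
      unfolding y'_def using mem by (rule inv_into_into, rule f_inv_into_f)
    then have "\<kappa> (PL y') = \<kappa> (PL (y p))" by (simp add: P q_def)
    then have "PL y' = PL (y p)" using inj_\<kappa> PL_Lsp by (simp add: inj_on_eq_iff)
    then have "y' = y p" using y3[OF p] y'(1) by (simp add: ME_iff vec3_eq_iff)
    then show "y p \<in> ME (r j)" "norm (Q p - q p) \<le> \<beta> * norm (q p)"
      using y'(1) near by (auto simp: y'_def Q y_def)
  qed
  have "norm (Q p - q p) \<le> norm (q p) / 2" if "p \<in> R" for p
    using Q_q[OF that] mult_right_mono[OF \<beta>(2) norm_ge_zero[of "q p"]] by simp
  note Q_q = this

  \<comment> \<open>Continuity of the angle and of the return map\<close>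
  have "compact R" "convex R" by (auto simp: R_def compact_Times convex_Times)
  \<comment> \<open>Heights on the compact set are at least \<open>\<Delta>1\<close>, and
    transversality holds because exit points lie in \<open>ME (r j)\<close>.\<close>
  have "continuous_on (cyl \<omega> ` R) (exit_time G)"
  proof (rule continuous_on_exit_time[of _ \<Delta>1])
    show "closed (cyl \<omega> ` R)"
      by (intro compact_imp_closed compact_continuous_image continuous_on_cyl \<open>compact R\<close>)
    show "vector_derivative (\<lambda>t. G t (inner_map G x)) (at 0) \<notin> Lsp" if "x \<in> cyl \<omega> ` R" for x
      using that ext(7)[OF y_ME] by (auto simp: y_def)
  qed (use cyl_B1 snd_R \<Delta>1_pos diff_t in auto)
  then have cont_ex: "continuous_on R (\<lambda>p. exit_time G (cyl \<omega> p))"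
    by (rule continuous_on_compose2[OF _ continuous_on_cyl]) auto
  have nz: "PL (G t (cyl \<omega> p)) \<noteq> 0" if p: "p \<in> R" and t: "t \<in> {0..exit_time G (cyl \<omega> p)}" for p t
  proof -
    have "norm (PL (cyl \<omega> p)) * exp (\<sigma> * t - (t + 1) * m) \<le> norm (PL (G t (cyl \<omega> p)))"
      using t snd_R[OF p] by (intro orbit_bounds(4)[OF cyl_B1[OF p]] ex(3)[OF p]) auto
    moreover have "norm (PL (cyl \<omega> p)) = 1" using cyl_mem_MI by (simp add: MI_def)
    ultimately show ?thesis using exp_gt_zero[of "\<sigma> * t - (t + 1) * m"] by auto
  qed
  have cont_\<Phi>: "continuous_on R \<Phi>"
    unfolding \<Phi> by (rule angle_fun(1)[OF \<open>convex R\<close> cont_ex]) (fact ex(1) nz)+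
  have angle: "PL (y p) = \<rho> p *\<^sub>R vector [cos (\<Phi> p), sin (\<Phi> p), 0]" if "p \<in> R" for p
    unfolding \<Phi> \<rho>_def y_def
    by (rule angle_fun(2)[OF \<open>convex R\<close> cont_ex]) (fact ex(1) nz that)+
  have "continuous_on R y"
    unfolding y_def inner_map_def by (intro continuous_intros cont_ex continuous_on_cyl)
  moreover have "continuous_on (ME (r j)) E"
  proof -
    have "continuous_on (ME (r j)) (tt j)"
      using ext(4) unfolding C1_on_def
      by (meson continuous_on_eq_continuous_within has_derivative_continuous)
    then show ?thesis unfolding E by (intro continuous_intros)
  qed
  ultimately have "continuous_on R (\<lambda>p. E (y p))"
    using y_ME by (auto intro: continuous_on_compose2)
  then have "continuous_on R (\<lambda>p. cyl_inv \<omega> (E (y p)))"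
    by (rule continuous_on_compose2[OF continuous_on_cyl_inv]) (use E_ME y_ME in auto)
  then have cont_Q: "continuous_on R Q" by (simp add: Q y_def comp_def)

  \<comment> \<open>Return map on the lines of critical angle\<close>
  have q_along_w: "q p = (0, a * \<rho> p / norm w)"
    if p: "p \<in> R" and a: "vector [cos (\<Phi> p), sin (\<Phi> p), 0] = (a / norm w) *\<^sub>R w" for p a
  proof -
    \<comment> \<open>The factor \<open>a\<close> will be 1 for the angle \<open>\<psi>j\<close> and
      -1 for the opposite one; \<kappa> maps \<open>w\<close> to \<open>(0, 1)\<close>.\<close>
    have "PL (y p) = 0 *\<^sub>R v + (a * \<rho> p / norm w) *\<^sub>R w"
      unfolding angle[OF p] a by (simp add: mult.commute)
    then show ?thesis unfolding q_def using coords(1) by metis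
  qed
  have "w \<noteq> 0" using ind[of 0 1] by auto
  have norm_q: "norm (q p) = \<bar>snd (q p)\<bar>" if "fst (q p) = 0" for p
    using that by (cases "q p") (simp add: norm_Pair)
  have snd_Q: "\<bar>snd (Q p) - snd (q p)\<bar> \<le> norm (q p) / 2" if "p \<in> R" for p
    using snd_le[of "Q p - q p"] Q_q[OF that] by simp
  have cont_edge: "continuous_on {-\<alpha>..\<alpha>} (\<lambda>\<psi>. \<Phi> (\<psi>, d))" if "d \<in> {\<Delta>1..\<Delta>2}" for d
    using that by (intro continuous_on_compose2[OF cont_\<Phi>] continuous_intros) (auto simp: R_def)
  show ?thesis
  proof (intro allI impI)
    fix i :: "nat \<Rightarrow> nat" assume "\<forall>n. i n \<in> {0, 1}"
    have "\<exists>x. (\<forall>n. x (Suc n) = Q (x n)) \<and> (\<forall>n. x n \<in> (if i n = 0 then M0 else M1))"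
    proof (rule itinerary_trajectories[OF _ \<Delta>1_less R_def cont_\<Phi> cont_Q, of \<psi>j pi])
      fix p assume p: "p \<in> R"
      have "norm (Q p) \<le> norm (q p) + norm (Q p - q p)" using norm_triangle_sub[of "Q p" "q p"] by simp
      then have "\<bar>fst (Q p)\<bar> \<le> \<alpha>" using fst_le[of "Q p"] Q_q[OF p] q_upper[OF p] by linarith
      then show "fst (Q p) \<in> {-\<alpha>..\<alpha>}" by auto
    next
      fix \<psi> assume \<psi>: "\<psi> \<in> {-\<alpha>..\<alpha>}"
      \<comment> \<open>Compactness makes the supremum \<open>m1\<close> and the infimum
        \<open>m2\<close> genuine bounds on the two edges.\<close>
      have "compact ((\<lambda>\<psi>. \<Phi> (\<psi>, \<Delta>1)) ` {-\<alpha>..\<alpha>})" "compact ((\<lambda>\<psi>. \<Phi> (\<psi>, \<Delta>2)) ` {-\<alpha>..\<alpha>})"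
        using \<Delta>1_less by (intro compact_continuous_image cont_edge compact_Icc; simp)+
      then have "bdd_above ((\<lambda>\<psi>. \<Phi> (\<psi>, \<Delta>1)) ` {-\<alpha>..\<alpha>})" "bdd_below ((\<lambda>\<psi>. \<Phi> (\<psi>, \<Delta>2)) ` {-\<alpha>..\<alpha>})"
        by (auto dest!: compact_imp_bounded intro: bounded_imp_bdd_above bounded_imp_bdd_below)
      then have "\<Phi> (\<psi>, \<Delta>1) \<le> m1" "m2 \<le> \<Phi> (\<psi>, \<Delta>2)"
        unfolding m1 m2 using \<psi> by (auto intro: cSUP_upper cINF_lower)
      then show "\<Phi> (\<psi>, \<Delta>1) \<le> \<psi>j - pi" "\<psi>j + pi \<le> \<Phi> (\<psi>, \<Delta>2)" using \<psi>j by auto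
    next
      fix p assume p: "p \<in> R" "\<Phi> p = \<psi>j"
      then have q: "q p = (0, 1 * \<rho> p / norm w)" using \<psi>j(3) by (intro q_along_w) auto
      then have "snd (q p) = norm (q p)" using norm_q[of p] \<rho>_pos[OF p(1)] by simp
      \<comment> \<open>With the error at most half of \<open>norm (q p)\<close>, the bound
        \<open>q_lower\<close> leaves more than \<open>sqrt 2 * \<Delta>2\<close>.\<close>
      then have "norm (q p) / 2 \<le> snd (Q p)" using snd_Q[OF p(1)] by linarith
      moreover have "1 * \<Delta>2 \<le> sqrt 2 * \<Delta>2" using \<Delta>2(1) by (intro mult_right_mono) auto
      ultimately show "\<Delta>2 < snd (Q p)" using q_lower[OF p(1)] by linarith
    next
      fix p assume p: "p \<in> R" "\<Phi> p = \<psi>j - pi \<or> \<Phi> p = \<psi>j + pi"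
      then have "vector [cos (\<Phi> p), sin (\<Phi> p), 0] = - (vector [cos \<psi>j, sin \<psi>j, 0] :: real^3)"
        by (auto simp: vec3_eq_iff)
      then have q: "q p = (0, - 1 * \<rho> p / norm w)" using \<psi>j(3) by (intro q_along_w p(1)) auto
      then have "snd (q p) = - norm (q p)" using norm_q[of p] \<rho>_pos[OF p(1)] by simp
      moreover have "0 \<le> norm (q p)" by simp
      \<comment> \<open>On the opposite ray the error cannot change the sign of the second
        component.\<close>
      ultimately have "snd (Q p) \<le> 0" using snd_Q[OF p(1)] by linarith
      then show "snd (Q p) < \<Delta>1" using \<Delta>1_pos by simp
    qed (use \<alpha> M0 M1 in \<open>auto simp: R_def\<close>)
    then obtain x where x: "\<And>n. x (Suc n) = Q (x n)" "\<And>n. x n \<in> (if i n = 0 then M0 else M1)"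
      by blast
    have R: "x n \<in> {-\<alpha>..\<alpha>} \<times> {\<Delta>1..\<Delta>2}" for n using x(2)[of n] by (auto simp: M0 M1 split: if_splits)
    \<comment> \<open>\<open>Q (x n)\<close> is the next point of the trajectory, which lies in the
      rectangle.\<close>
    moreover have "\<Delta>1 \<le> snd (Q (x n))" "snd (Q (x n)) \<le> \<Delta>2" for n
      using R[of "Suc n"] by (auto simp: x(1))
    ultimately show "\<exists>x. (\<forall>n. x (Suc n) = Q (x n)) \<and> (\<forall>n. x n \<in> {-\<alpha>..\<alpha>} \<times> {\<Delta>1..\<Delta>2}) \<and>
      (\<forall>n. x n \<in> (if i n = 0 then M0 else M1) \<and> \<Delta>1 \<le> snd (Q (x n)) \<and> snd (Q (x n)) \<le> \<Delta>2)"
      using x by (intro exI[of _ x]) blast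
  qed
qed

end
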